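(* Let $a\geq 2$, $b\geq 1$ be integers. Let $U\subset Q(a,b)$ be a (nonempty) connected open set and let $f\colon U\to Q(\infty,B)$, where $B\in\mathbb{N}_0\cup\{\infty\}$, be a real-analytic CR mapping such that $f(U)$ is not contained in any complex hyperplane of $\ell^2$. Then $B=\infty$.
   Context: $\mathbb{N}_0=\mathbb{N}\cup\{0\}$. For integers $a,b$, $$Q(a,b)=\Bigl\{z\in\mathbb{C}^{a+b}:\sum_{j=1}^a|z_j|^2-\sum_{j=a+1}^{a+b}|z_j|^2=1\Bigr\}.$$ In the complex Hilbert space $\ell^2$, for finite $b\in\mathbb{N}_0$, $$Q(\infty,b)=\Bigl\{z\in\ell^2:-\sum_{j=1}^b|z_j|^2+\sum_{j=b+1}^\infty|z_j|^2=1\Bigr\},\qquad Q(\infty,\infty)=\Bigl\{z\in\ell^2:\sum_{j=1}^\infty\bigl(|z_{2j-1}|^2-|z_{2j}|^2\bigr)=1\Bigr\}.$$ "Open" means relatively open in $Q(a,b)$. A real-analytic CR mapping from $U$ to $Q(\infty,B)$ is (the restriction to $U$ of) a holomorphic mapping to $\ell^2$ defined on a neighborhood of $U$ in $\mathbb{C}^{a+b}$ and taking $U$ into $Q(\infty,B)$. A complex hyperplane is a complex (closed) affine subspace of complex codimension one. *)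

theory Defs
  imports "HOL-Analysis.Analysis"
begin

section \<open>The complex Hilbert space of square-summable sequences\<close>

typedef ell2 = "{x :: nat \<Rightarrow> complex. summable (\<lambda>n. (cmod (x n))\<^sup>2)}"
  morphisms coord Abs_ell2
  by (rule exI[of _ "\<lambda>_. 0"]) simp

setup_lifting type_definition_ell2

lemma ell2_eqI: "(\<And>n. coord x n = coord y n) \<Longrightarrow> x = y"
  by (metis coord_inject ext)

lemma summable_coord: "summable (\<lambda>n. (cmod (coord x n))\<^sup>2)"
  using coord[of x] by simp

lemma square_summable_add:
  assumes "summable (\<lambda>n. (cmod (x n))\<^sup>2)" "summable (\<lambda>n. (cmod (y n))\<^sup>2)"
  shows "summable (\<lambda>n. (cmod (x n + y n))\<^sup>2)"
proof (rule summable_comparison_test)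
  show "summable (\<lambda>n. 2 * (cmod (x n))\<^sup>2 + 2 * (cmod (y n))\<^sup>2)"
    using assms by (intro summable_add summable_mult)
  have "(cmod (x n + y n))\<^sup>2 \<le> 2 * (cmod (x n))\<^sup>2 + 2 * (cmod (y n))\<^sup>2" for n
  proof -
    have "(cmod (x n + y n))\<^sup>2 \<le> (cmod (x n) + cmod (y n))\<^sup>2"
      by (intro power_mono norm_triangle_ineq) simp
    also have "\<dots> \<le> 2 * (cmod (x n))\<^sup>2 + 2 * (cmod (y n))\<^sup>2"
      using zero_le_power2[of "cmod (x n) - cmod (y n)"]
      by (simp add: power2_eq_square algebra_simps)
    finally show ?thesis .
  qed
  then show "\<exists>N. \<forall>n\<ge>N. norm ((cmod (x n + y n))\<^sup>2) \<le> 2 * (cmod (x n))\<^sup>2 + 2 * (cmod (y n))\<^sup>2"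
    by simp
qed

lemma square_summable_scale:
  "summable (\<lambda>n. (cmod (x n))\<^sup>2) \<Longrightarrow> summable (\<lambda>n. (cmod (c * x n))\<^sup>2)"
  by (simp add: norm_mult power_mult_distrib summable_mult)

lift_definition scaleC :: "complex \<Rightarrow> ell2 \<Rightarrow> ell2" (infixr "*\<^sub>C" 75)
  is "\<lambda>c x n. c * x n"
  by (simp add: square_summable_scale)

text \<open>The real-valued inner product below is the real part of the Hermitian inner product;
  it induces the usual norm of the complex Hilbert space.\<close>

instantiation ell2 :: real_inner
begin

lift_definition zero_ell2 :: ell2 is "\<lambda>_. 0"
  by simp

lift_definition plus_ell2 :: "ell2 \<Rightarrow> ell2 \<Rightarrow> ell2" is "\<lambda>x y n. x n + y n"
  by (simp add: square_summable_add)

lift_definition uminus_ell2 :: "ell2 \<Rightarrow> ell2" is "\<lambda>x n. - x n"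
  by simp

lift_definition minus_ell2 :: "ell2 \<Rightarrow> ell2 \<Rightarrow> ell2" is "\<lambda>x y n. x n - y n"
  subgoal for x y
    using square_summable_add[of x "\<lambda>n. - y n"] by simp
  done

definition scaleR_ell2 :: "real \<Rightarrow> ell2 \<Rightarrow> ell2" where
  "r *\<^sub>R x = complex_of_real r *\<^sub>C x"

definition inner_ell2 :: "ell2 \<Rightarrow> ell2 \<Rightarrow> real" where
  "x \<bullet> y = (\<Sum>n. Re (coord x n * cnj (coord y n)))"

definition norm_ell2 :: "ell2 \<Rightarrow> real" where
  "norm x = sqrt (\<Sum>n. (cmod (coord x n))\<^sup>2)"

definition dist_ell2 :: "ell2 \<Rightarrow> ell2 \<Rightarrow> real" where
  "dist (x :: ell2) y = norm (x - y)"

definition sgn_ell2 :: "ell2 \<Rightarrow> ell2" where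
  "sgn (x :: ell2) = inverse (norm x) *\<^sub>R x"

definition uniformity_ell2 :: "(ell2 \<times> ell2) filter" where
  "uniformity_ell2 = (INF e\<in>{0<..}. principal {(x, y). dist x y < e})"

definition open_ell2 :: "ell2 set \<Rightarrow> bool" where
  "open_ell2 U \<longleftrightarrow> (\<forall>x\<in>U. \<forall>\<^sub>F (x', y) in uniformity. x' = x \<longrightarrow> y \<in> U)"

instance
proof
  note coord_defs = zero_ell2.rep_eq plus_ell2.rep_eq uminus_ell2.rep_eq minus_ell2.rep_eq
    scaleR_ell2_def scaleC.rep_eq
  fix x y z :: ell2 and r s :: real
  show "x + y + z = x + (y + z)" "x + y = y + x" "0 + x = x" "- x + x = 0" "x - y = x + - y"
    "r *\<^sub>R (x + y) = r *\<^sub>R x + r *\<^sub>R y" "(r + s) *\<^sub>R x = r *\<^sub>R x + s *\<^sub>R x"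
    "r *\<^sub>R s *\<^sub>R x = (r * s) *\<^sub>R x" "1 *\<^sub>R x = x"
    by (auto intro!: ell2_eqI simp: coord_defs algebra_simps)
  show "dist x y = norm (x - y)" "sgn x = inverse (norm x) *\<^sub>R x"
    by (simp_all add: dist_ell2_def sgn_ell2_def)
  show "uniformity = (INF e\<in>{0<..}. principal {(x, y :: ell2). dist x y < e})"
    by (rule uniformity_ell2_def)
  show "open U \<longleftrightarrow> (\<forall>x\<in>U. \<forall>\<^sub>F (x', y) in uniformity. x' = x \<longrightarrow> y \<in> U)" for U :: "ell2 set"
    by (rule open_ell2_def)
  have summable_inner: "summable (\<lambda>n. Re (coord x n * cnj (coord y n)))" for x y
  proof (rule summable_comparison_test)
    show "summable (\<lambda>n. (cmod (coord x n))\<^sup>2 + (cmod (coord y n))\<^sup>2)"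
      by (intro summable_add summable_coord)
    have "\<bar>Re (u * cnj v)\<bar> \<le> (cmod u)\<^sup>2 + (cmod v)\<^sup>2" for u v
    proof -
      have "\<bar>Re (u * cnj v)\<bar> \<le> cmod u * cmod v"
        using abs_Re_le_cmod[of "u * cnj v"] by (simp add: norm_mult)
      also have "\<dots> \<le> (cmod u)\<^sup>2 + (cmod v)\<^sup>2"
        using sum_squares_bound[of "cmod u" "cmod v"] mult_nonneg_nonneg[of "cmod u" "cmod v"]
        by (simp del: mult_nonneg_nonneg)
      finally show ?thesis .
    qed
    then show "\<exists>N. \<forall>n\<ge>N. norm (Re (coord x n * cnj (coord y n)))
        \<le> (cmod (coord x n))\<^sup>2 + (cmod (coord y n))\<^sup>2"
      by simp
  qed
  show "x \<bullet> y = y \<bullet> x"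
    by (simp add: inner_ell2_def algebra_simps)
  show "(x + y) \<bullet> z = x \<bullet> z + y \<bullet> z"
  proof -
    have "(x + y) \<bullet> z
        = (\<Sum>n. Re (coord x n * cnj (coord z n)) + Re (coord y n * cnj (coord z n)))"
      by (simp add: inner_ell2_def plus_ell2.rep_eq algebra_simps)
    also have "\<dots> = x \<bullet> z + y \<bullet> z"
      unfolding inner_ell2_def by (rule suminf_add[symmetric]) (rule summable_inner)+
    finally show ?thesis .
  qed
  show "r *\<^sub>R x \<bullet> y = r * (x \<bullet> y)"
  proof -
    have "r *\<^sub>R x \<bullet> y = (\<Sum>n. r * Re (coord x n * cnj (coord y n)))"
      by (simp add: inner_ell2_def scaleR_ell2_def scaleC.rep_eq algebra_simps)
    also have "\<dots> = r * (x \<bullet> y)"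
      unfolding inner_ell2_def by (rule suminf_mult) (rule summable_inner)
    finally show ?thesis .
  qed
  have inner_self: "x \<bullet> x = (\<Sum>n. (cmod (coord x n))\<^sup>2)"
    by (simp only: inner_ell2_def complex_norm_square[symmetric] Re_complex_of_real)
  show "0 \<le> x \<bullet> x"
    unfolding inner_self by (intro suminf_nonneg summable_coord) simp
  show "x \<bullet> x = 0 \<longleftrightarrow> x = 0"
    unfolding inner_self
    by (subst suminf_eq_zero_iff[OF summable_coord])
      (auto intro!: ell2_eqI simp: zero_ell2.rep_eq)
  show "norm x = sqrt (x \<bullet> x)"
    by (simp add: norm_ell2_def inner_self)
qed

end

lemma coord_simps [simp]:
  "coord 0 n = 0" "coord (x + y) n = coord x n + coord y n" "coord (- x) n = - coord x n"
  "coord (x - y) n = coord x n - coord y n" "coord (c *\<^sub>C x) n = c * coord x n"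
  "coord (r *\<^sub>R x) n = r *\<^sub>R coord x n"
  by (simp_all add: zero_ell2.rep_eq plus_ell2.rep_eq uminus_ell2.rep_eq minus_ell2.rep_eq
      scaleR_ell2_def scaleC.rep_eq scaleR_conv_of_real)

lemma norm_ell2_sq: "(norm (x :: ell2))\<^sup>2 = (\<Sum>n. (cmod (coord x n))\<^sup>2)"
  unfolding norm_ell2_def by (simp add: suminf_nonneg summable_coord)

lemma sum_coord_le_norm:
  fixes x :: ell2
  shows "(\<Sum>n<M. (cmod (coord x n))\<^sup>2) \<le> (norm x)\<^sup>2"
  unfolding norm_ell2_sq by (rule sum_le_suminf[OF summable_coord]) auto

lemma cmod_coord_le_norm: "cmod (coord x n) \<le> norm x"
proof (rule power2_le_imp_le)
  have "(cmod (coord x n))\<^sup>2 \<le> (\<Sum>k<Suc n. (cmod (coord x k))\<^sup>2)"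
    by (rule member_le_sum) auto
  then show "(cmod (coord x n))\<^sup>2 \<le> (norm x)\<^sup>2"
    using sum_coord_le_norm[of x "Suc n"] by linarith
qed simp

lemma norm_scaleC: "norm (c *\<^sub>C x) = cmod c * norm x"
  by (simp add: norm_ell2_def norm_mult power_mult_distrib suminf_mult[OF summable_coord]
      real_sqrt_mult)

global_interpretation ell2: vector_space scaleC
  by unfold_locales (auto intro!: ell2_eqI simp: algebra_simps)

instance ell2 :: complete_space
proof
  fix X :: "nat \<Rightarrow> ell2"
  assume "Cauchy X"
  have "Cauchy (\<lambda>m. coord (X m) n)" for n
  proof (rule metric_CauchyI)
    fix e :: real assume "e > 0"
    then obtain M where M: "\<forall>m\<ge>M. \<forall>k\<ge>M. dist (X m) (X k) < e"
      using metric_CauchyD[OF \<open>Cauchy X\<close>] by blast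
    have "dist (coord (X m) n) (coord (X k) n) \<le> dist (X m) (X k)" for m k
      using cmod_coord_le_norm[of "X m - X k" n] by (simp add: dist_norm)
    then show "\<exists>M. \<forall>m\<ge>M. \<forall>k\<ge>M. dist (coord (X m) n) (coord (X k) n) < e"
      using M by (meson le_less_trans)
  qed
  then have "convergent (\<lambda>m. coord (X m) n)" for n
    by (rule Cauchy_convergent)
  then obtain l where l: "\<And>n. (\<lambda>m. coord (X m) n) \<longlonglongrightarrow> l n"
    unfolding convergent_def by metis
  have tail: "\<exists>N. \<forall>m\<ge>N. \<forall>M. (\<Sum>n<M. (cmod (coord (X m) n - l n))\<^sup>2) \<le> e\<^sup>2" if "e > 0" for e
  proof -
    obtain N where N: "\<forall>m\<ge>N. \<forall>k\<ge>N. dist (X m) (X k) < e"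
      using metric_CauchyD[OF \<open>Cauchy X\<close> \<open>e > 0\<close>] by blast
    have "(\<Sum>n<M. (cmod (coord (X m) n - l n))\<^sup>2) \<le> e\<^sup>2" if "m \<ge> N" for m M
    proof (rule LIMSEQ_le_const2)
      show "(\<lambda>k. \<Sum>n<M. (cmod (coord (X m) n - coord (X k) n))\<^sup>2)
          \<longlonglongrightarrow> (\<Sum>n<M. (cmod (coord (X m) n - l n))\<^sup>2)"
        by (intro tendsto_intros l)
      have "(\<Sum>n<M. (cmod (coord (X m) n - coord (X k) n))\<^sup>2) \<le> e\<^sup>2" if "k \<ge> N" for k
      proof -
        have "(\<Sum>n<M. (cmod (coord (X m) n - coord (X k) n))\<^sup>2) \<le> (norm (X m - X k))\<^sup>2"
          using sum_coord_le_norm[of "X m - X k" M] by simp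
        also have "\<dots> \<le> e\<^sup>2"
          using N \<open>m \<ge> N\<close> \<open>k \<ge> N\<close> by (intro power_mono) (auto simp: dist_norm less_imp_le)
        finally show ?thesis .
      qed
      then show "\<exists>K. \<forall>k\<ge>K. (\<Sum>n<M. (cmod (coord (X m) n - coord (X k) n))\<^sup>2) \<le> e\<^sup>2"
        by blast
    qed
    then show ?thesis by blast
  qed
  have "summable (\<lambda>n. (cmod (l n))\<^sup>2)"
  proof -
    obtain m where m: "\<And>M. (\<Sum>n<M. (cmod (coord (X m) n - l n))\<^sup>2) \<le> 1\<^sup>2"
      using tail[of 1] by auto
    have "summable (\<lambda>n. (cmod (coord (X m) n - l n))\<^sup>2)"
      by (rule bounded_imp_summable[of _ 1]) (use m[of "Suc _"] in \<open>auto simp: lessThan_Suc_atMost\<close>)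
    then have "summable (\<lambda>n. (cmod (l n - coord (X m) n))\<^sup>2)"
      by (simp add: norm_minus_commute)
    from square_summable_add[OF this summable_coord[of "X m"]] show ?thesis
      by simp
  qed
  then obtain L where L: "coord L = l"
    by (metis Abs_ell2_inverse mem_Collect_eq)
  have "X \<longlonglongrightarrow> L"
  proof (rule metric_LIMSEQ_I)
    fix e :: real assume "e > 0"
    then obtain N where
      N: "\<forall>m\<ge>N. \<forall>M. (\<Sum>n<M. (cmod (coord (X m) n - l n))\<^sup>2) \<le> (e/2)\<^sup>2"
      using tail[of "e/2"] by auto
    have "dist (X m) L < e" if "m \<ge> N" for m
    proof -
      have "(norm (X m - L))\<^sup>2 \<le> (e/2)\<^sup>2"
        unfolding norm_ell2_sq
        by (rule suminf_le_const[OF summable_coord]) (use N that L in auto)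
      then have "norm (X m - L) \<le> e/2"
        by (rule power2_le_imp_le) (use \<open>e > 0\<close> in simp)
      then show ?thesis
        using \<open>e > 0\<close> by (simp add: dist_norm)
    qed
    then show "\<exists>N. \<forall>m\<ge>N. dist (X m) L < e"
      by blast
  qed
  then show "convergent X"
    by (auto simp: convergent_def)
qed

instance ell2 :: banach ..

text \<open>An affine subspace is a translate of a linear subspace \<^term>\<open>W\<close>; the codimension is the
  dimension of the quotient by \<^term>\<open>W\<close>, which is one iff the quotient is spanned by the class
  of a single vector outside \<^term>\<open>W\<close>.\<close>

definition complex_hyperplane :: "ell2 set \<Rightarrow> bool" where
  "complex_hyperplane H \<longleftrightarrow>
     (\<exists>p W. H = (+) p ` W \<and> ell2.subspace W \<and> closed W \<and>
        (\<exists>v. v \<notin> W \<and> ell2.span (insert v W) = UNIV))"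


section \<open>Hyperquadrics\<close>

text \<open>\<open>Q(a,b)\<close> with \<open>a = CARD('a)\<close> and \<open>b = CARD('b)\<close>: the indices \<open>Inl j\<close> are the \<open>a\<close> positive
  directions and the indices \<open>Inr j\<close> are the \<open>b\<close> negative ones.\<close>

definition Q_fin :: "(complex ^ ('a::finite + 'b::finite)) set" where
  "Q_fin = {z. (\<Sum>j\<in>UNIV. (cmod (z $ Inl j))\<^sup>2) - (\<Sum>j\<in>UNIV. (cmod (z $ Inr j))\<^sup>2) = 1}"

text \<open>\<open>Q(\<infinity>,B)\<close>. Coordinates are indexed from 0, so for finite \<open>B\<close> the negative ones are those with
  index less than \<open>B\<close>, and for \<open>B = \<infinity>\<close> those with odd index.\<close>

definition Q_inf :: "enat \<Rightarrow> ell2 set" where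
  "Q_inf B = (case B of
     enat b \<Rightarrow> {z. - (\<Sum>j<b. (cmod (coord z j))\<^sup>2) + (\<Sum>j. (cmod (coord z (j + b)))\<^sup>2) = 1}
   | \<infinity> \<Rightarrow> {z. (\<Sum>j. (cmod (coord z (2 * j)))\<^sup>2 - (cmod (coord z (2 * j + 1)))\<^sup>2) = 1})"


section \<open>CR mappings\<close>

text \<open>Holomorphic means complex differentiable in the sense of Frechet: the derivative is
  complex linear.\<close>

definition holomorphic_ell2 :: "(complex ^ 'n::finite \<Rightarrow> ell2) \<Rightarrow> (complex ^ 'n) set \<Rightarrow> bool" where
  "holomorphic_ell2 F V \<longleftrightarrow>
     (\<forall>z\<in>V. \<exists>D. (F has_derivative D) (at z) \<and> Vector_Spaces.linear (*s) (*\<^sub>C) D)"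

text \<open>Only the values of \<^term>\<open>f\<close> on \<^term>\<open>U\<close> matter.\<close>

definition real_analytic_CR ::
  "(complex ^ 'n::finite) set \<Rightarrow> ell2 set \<Rightarrow> (complex ^ 'n \<Rightarrow> ell2) \<Rightarrow> bool" where
  "real_analytic_CR U Q f \<longleftrightarrow>
     (\<exists>V F. open V \<and> U \<subseteq> V \<and> holomorphic_ell2 F V \<and> (\<forall>z\<in>U. F z = f z)) \<and> f ` U \<subseteq> Q"

end

theory Submission
  imports Defs "HOL-Complex_Analysis.Conformal_Mappings" "Jordan_Normal_Form.Determinant"
begin

text \<open>Suppose \<open>B\<close> is finite. On a complex line contained in \<open>Q(a,b)\<close> polarization shows that the
  values of \<open>f\<close> are pairwise of product one for the form of signature \<open>(\<infinity>,B)\<close>, so a linear relation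
  among the vectors \<open>(1, f\<^sub>1, \<dots>, f\<^sub>B)\<close> at finitely many points of the line is a relation among the full
  values of \<open>f\<close>, and any \<open>B + 2\<close> values on the line are linearly dependent.
  This is the vanishing of minors depending holomorphically on the line, and the lines in \<open>Q(a,b)\<close>
  form a generic real submanifold of the space of lines (here \<open>a \<ge> 2\<close> and \<open>b \<ge> 1\<close> are used), so the
  minors vanish for all lines, in \<open>Q(a,b)\<close> or not, of an open set of lines. A holomorphic map whose
  values on all lines parallel to a spanning set of directions span spaces of bounded dimension has
  values in a finite-dimensional space; the identity theorem then puts \<open>f(U)\<close> in a hyperplane.\<close>

section \<open>Minors and linear systems\<close>

text \<open>Entries are functions of indices, so selecting or bordering rows is a plain update and
  the size \<open>r\<close> may vary inside a proof.\<close>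

definition minor :: "nat \<Rightarrow> (nat \<Rightarrow> nat \<Rightarrow> 'a::comm_ring_1) \<Rightarrow> 'a" where
  "minor r A = Determinant.det (Matrix.mat r r (\<lambda>(i, j). A i j))"

text \<open>A kernel vector is a relation between the columns. Below, columns are points and rows
  are coordinates.\<close>

lemma minor_eq_0_iff:
  fixes A :: "nat \<Rightarrow> nat \<Rightarrow> 'a::field"
  shows "minor r A = 0 \<longleftrightarrow> (\<exists>c. (\<exists>j<r. c j \<noteq> 0) \<and> (\<forall>i<r. (\<Sum>j<r. c j * A i j) = 0))"
proof -
  let ?M = "Matrix.mat r r (\<lambda>(i, j). A i j)"
  have M: "?M \<in> carrier_mat r r"
    by simp
  have prod: "?M *\<^sub>v v = 0\<^sub>v r \<longleftrightarrow> (\<forall>i<r. (\<Sum>j<r. vec_index v j * A i j) = 0)" if "v \<in> carrier_vec r" for v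
    using that by (auto simp: vec_eq_iff scalar_prod_def lessThan_atLeast0 mult.commute)
  have nz: "v \<noteq> 0\<^sub>v r \<longleftrightarrow> (\<exists>j<r. vec_index v j \<noteq> 0)" if "v \<in> carrier_vec r" for v :: "'a Matrix.vec"
    using that by (auto simp: vec_eq_iff)
  show ?thesis
    unfolding minor_def det_0_iff_vec_prod_zero_field[OF M]
  proof safe
    fix v assume v: "v \<in> carrier_vec r" "v \<noteq> 0\<^sub>v r" "?M *\<^sub>v v = 0\<^sub>v r"
    then show "\<exists>c. (\<exists>j<r. c j \<noteq> 0) \<and> (\<forall>i<r. (\<Sum>j<r. c j * A i j) = 0)"
      using prod nz by (intro exI[of _ "\<lambda>j. vec_index v j"]) auto
  next
    fix c j assume c: "\<forall>i<r. (\<Sum>j<r. c j * A i j) = 0" "j < r" "c j \<noteq> 0"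
    have "Matrix.vec r c \<in> carrier_vec r"
      by simp
    with c show "\<exists>v. v \<in> carrier_vec r \<and> v \<noteq> 0\<^sub>v r \<and> ?M *\<^sub>v v = 0\<^sub>v r"
      by (intro exI[of _ "Matrix.vec r c"]) (auto simp: prod nz)
  qed
qed

lemma minor_0 [simp]: "minor 0 A = 1"
  by (simp add: minor_def)

text \<open>Laplace expansion along the last row: its cofactors do not involve that row, so one
  \<open>C\<close> serves every \<open>x\<close>, and the last cofactor is the smaller
  minor.\<close>

lemma minor_Suc_expand:
  "\<exists>C. C r = minor r A \<and> (\<forall>x. minor (Suc r) (\<lambda>i j. if i < r then A i j else x j) = (\<Sum>j\<le>r. x j * C j))"
proof -
  define B where "B x = Matrix.mat (Suc r) (Suc r) (\<lambda>(i, j). if i < r then A i j else x j)" for x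
  have cof: "cofactor (B x) r j = cofactor (B (\<lambda>_. 0)) r j" for x j
    unfolding cofactor_def mat_delete_def
    by (intro arg_cong2[where f = "(*)"] arg_cong[of _ _ Determinant.det] eq_matI refl)
      (auto simp: B_def)
  have "cofactor (B x) r r = minor r A" for x
    unfolding cofactor_def mat_delete_def minor_def
    by (simp, intro arg_cong[of _ _ Determinant.det] eq_matI) (auto simp: B_def)
  moreover have "minor (Suc r) (\<lambda>i j. if i < r then A i j else x j)
      = (\<Sum>j\<le>r. x j * cofactor (B (\<lambda>_. 0)) r j)" for x
    unfolding minor_def B_def[symmetric]
    by (subst laplace_expansion_row[of _ "Suc r" r])
      (auto simp: B_def[of x] lessThan_Suc_atMost cof[of x, unfolded B_def[of x]] intro!: sum.cong)
  ultimately show ?thesis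
    by (intro exI[of _ "\<lambda>j. cofactor (B (\<lambda>_. 0)) r j"]) simp
qed

lemma minor_cong: "(\<And>i j. i < r \<Longrightarrow> j < r \<Longrightarrow> A i j = A' i j) \<Longrightarrow> minor r A = minor r A'"
  unfolding minor_def by (intro arg_cong[of _ _ Determinant.det] eq_matI) auto

lemma holomorphic_on_minor:
  assumes "\<And>i j. i < r \<Longrightarrow> j < r \<Longrightarrow> (\<lambda>z. A z i j) holomorphic_on S"
  shows "(\<lambda>z. minor r (A z)) holomorphic_on S"
proof -
  have eq: "minor r (A z) = (\<Sum>p | p permutes {0..<r}. signof p * (\<Prod>i = 0..<r. A z i (p i)))" for z
    unfolding minor_def
    by (subst det_def'[of _ r]) (auto intro!: sum.cong prod.cong simp: permutes_in_image[of _ "{0..<r}"])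
  have "p i < r" if "p permutes {0..<r}" "i < r" for p i
    using permutes_in_image[OF that(1), of i] that(2) by simp
  then show ?thesis
    unfolding eq by (intro holomorphic_intros assms) auto
qed

text \<open>Padding with zero rows gives a square system whose last row is zero, hence a singular
  one.\<close>

lemma nontrivial_solution:
  fixes A :: "nat \<Rightarrow> nat \<Rightarrow> 'a::field"
  assumes "m < n"
  shows "\<exists>c. (\<exists>j<n. c j \<noteq> 0) \<and> (\<forall>i<m. (\<Sum>j<n. c j * A i j) = 0)"
proof -
  obtain r where n: "n = Suc r" "m \<le> r"
    using assms by (cases n) auto
  let ?A = "\<lambda>i j. if i < m then A i j else 0"
  obtain C where "minor (Suc r) (\<lambda>i j. if i < r then ?A i j else 0) = (\<Sum>j\<le>r. 0 * C j)"
    using minor_Suc_expand[of r ?A] by auto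
  then have "minor n (\<lambda>i j. if i < r then ?A i j else 0) = 0"
    by (simp add: n)
  then obtain c where c: "\<exists>j<n. c j \<noteq> 0"
      "\<forall>i<n. (\<Sum>j<n. c j * (if i < r then ?A i j else 0)) = 0"
    unfolding minor_eq_0_iff by blast
  have "(\<Sum>j<n. c j * A i j) = 0" if "i < m" for i
    using c(2)[rule_format, of i] that n by auto
  with c(1) show ?thesis by blast
qed

section \<open>The indefinite form on the sequence space\<close>

lemma scaleC_eq_scaleR: "c *\<^sub>C x = Re c *\<^sub>R x + Im c *\<^sub>R (\<i> *\<^sub>C x)"
proof (rule ell2_eqI)
  fix n
  have "c * coord x n = (of_real (Re c) + \<i> * of_real (Im c)) * coord x n"
    by (subst complex_eq[of c]) (rule refl)
  then show "coord (c *\<^sub>C x) n = coord (Re c *\<^sub>R x + Im c *\<^sub>R (\<i> *\<^sub>C x)) n"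
    by (simp add: scaleR_conv_of_real algebra_simps)
qed

lemma inner_scaleC_ii: "(\<i> *\<^sub>C x) \<bullet> (\<i> *\<^sub>C y) = x \<bullet> y"
  by (simp add: inner_ell2_def algebra_simps)

lemma inner_scaleC_i_left: "(\<i> *\<^sub>C x) \<bullet> y = - (x \<bullet> (\<i> *\<^sub>C y))"
proof -
  have "(\<i> *\<^sub>C x) \<bullet> y = (\<i> *\<^sub>C \<i> *\<^sub>C x) \<bullet> (\<i> *\<^sub>C y)"
    by (simp only: inner_scaleC_ii)
  also have "\<i> *\<^sub>C \<i> *\<^sub>C x = - x"
    by (rule ell2_eqI) (simp add: mult.assoc[symmetric])
  finally show ?thesis by simp
qed

text \<open>The Hermitian product, linear in the first argument: multiplying the second argument by
  \<open>\<i>\<close> turns the imaginary part into the real part.\<close>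

definition cinner :: "ell2 \<Rightarrow> ell2 \<Rightarrow> complex" where
  "cinner x y = Complex (x \<bullet> y) (x \<bullet> (\<i> *\<^sub>C y))"

lemma cinner_scaleC_left: "cinner (c *\<^sub>C x) y = c * cinner x y"
  by (subst scaleC_eq_scaleR, simp add: cinner_def complex_eq_iff inner_add_left inner_scaleC_i_left inner_scaleC_ii)

lemma cinner_commute: "cinner y x = cnj (cinner x y)"
  using inner_scaleC_i_left[of x y]
  by (simp add: cinner_def complex_eq_iff inner_commute)

lemma cinner_scaleC_right: "cinner x (c *\<^sub>C y) = cnj c * cinner x y"
  by (metis cinner_commute cinner_scaleC_left complex_cnj_mult)

lemma scaleC_scaleR: "c *\<^sub>C r *\<^sub>R x = r *\<^sub>R c *\<^sub>C x"
  by (rule ell2_eqI) simp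

lemma bounded_bilinear_cinner: "bounded_bilinear cinner"
proof
  show "\<exists>K. \<forall>a b. norm (cinner a b) \<le> norm a * norm b * K"
  proof (intro exI allI)
    fix a b
    have "norm (cinner a b) \<le> \<bar>a \<bullet> b\<bar> + \<bar>a \<bullet> (\<i> *\<^sub>C b)\<bar>"
      using cmod_le[of "cinner a b"] by (simp add: cinner_def)
    also have "\<dots> \<le> norm a * norm b + norm a * norm (\<i> *\<^sub>C b)"
      by (intro add_mono Cauchy_Schwarz_ineq2)
    finally show "norm (cinner a b) \<le> norm a * norm b * 2"
      by (simp add: norm_scaleC)
  qed
qed (simp_all add: cinner_def complex_eq_iff inner_add_left inner_add_right
    ell2.scale_right_distrib scaleC_scaleR)

text \<open>The signature operator: applied to the second argument of \<open>cinner\<close> it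
  yields the form with \<open>b\<close> negative squares.\<close>

lift_definition flip :: "nat \<Rightarrow> ell2 \<Rightarrow> ell2"
  is "\<lambda>b x n. if n < b then - x n else x n"
  by (simp add: if_distrib[of cmod] if_distrib[of "\<lambda>x. x\<^sup>2"] cong: if_cong)

lemma coord_flip [simp]: "coord (flip b x) n = (if n < b then - coord x n else coord x n)"
  by (simp add: flip.rep_eq)

lemma flip_scaleC: "flip b (c *\<^sub>C x) = c *\<^sub>C flip b x"
  by (rule ell2_eqI) simp

lemma bounded_linear_flip: "bounded_linear (flip b)"
proof (rule bounded_linear_intro[where K = 1])
  have "norm (flip b x) = norm x" for x
    unfolding norm_ell2_def by (intro arg_cong[of _ _ sqrt] suminf_cong) simp
  then show "norm (flip b x) \<le> norm x * 1" for x
    by simp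
qed (auto intro!: ell2_eqI)

definition indef :: "nat \<Rightarrow> ell2 \<Rightarrow> ell2 \<Rightarrow> complex" where
  "indef b x y = cinner x (flip b y)"

lemma bounded_bilinear_indef: "bounded_bilinear (indef b)"
  using bounded_bilinear.comp[OF bounded_bilinear_cinner bounded_linear_ident bounded_linear_flip]
  by (simp add: indef_def[abs_def])

lemma indef_scaleC_left: "indef b (c *\<^sub>C x) y = c * indef b x y"
  by (simp add: indef_def cinner_scaleC_left)

lemma indef_scaleC_right: "indef b x (c *\<^sub>C y) = cnj c * indef b x y"
  by (simp add: indef_def flip_scaleC cinner_scaleC_right)

text \<open>Splitting off the first \<open>b\<close> terms identifies the real parts; the imaginary
  part of \<open>indef b z z\<close> vanishes term by term.\<close>

lemma Q_inf_enat_iff: "z \<in> Q_inf (enat b) \<longleftrightarrow> indef b z z = 1"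
proof -
  let ?q = "\<lambda>n. Re (coord z n * cnj (coord (flip b z) n))"
  have q: "?q n = (if n < b then - (cmod (coord z n))\<^sup>2 else (cmod (coord z n))\<^sup>2)" for n
    by (simp add: cmod_def power2_eq_square)
  have "summable (\<lambda>n. (cmod (coord z (n + b)))\<^sup>2)"
    using summable_coord[of z] by (subst summable_iff_shift)
  moreover have q_shift: "?q (n + b) = (cmod (coord z (n + b)))\<^sup>2" for n
    using q[of "n + b"] by simp
  ultimately have "summable ?q"
    by (subst summable_iff_shift[symmetric, of _ b]) simp
  then have "z \<bullet> flip b z = (\<Sum>n. ?q (n + b)) + (\<Sum>n<b. ?q n)"
    unfolding inner_ell2_def by (rule suminf_split_initial_segment)
  also have "(\<Sum>n. ?q (n + b)) = (\<Sum>n. (cmod (coord z (n + b)))\<^sup>2)"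
    by (intro suminf_cong q_shift)
  also have "(\<Sum>n<b. ?q n) = - (\<Sum>n<b. (cmod (coord z n))\<^sup>2)"
    unfolding sum_negf[symmetric] by (intro sum.cong refl) (simp only: q lessThan_iff if_True)
  finally have re: "z \<bullet> flip b z = - (\<Sum>j<b. (cmod (coord z j))\<^sup>2) + (\<Sum>j. (cmod (coord z (j + b)))\<^sup>2)"
    by simp
  have "z \<bullet> (\<i> *\<^sub>C flip b z) = 0"
  proof -
    have "Re (coord z n * cnj (coord (\<i> *\<^sub>C flip b z) n)) = 0" for n
      by (simp add: algebra_simps)
    then show ?thesis by (simp only: inner_ell2_def suminf_zero)
  qed
  then show ?thesis
    by (simp add: Q_inf_def indef_def cinner_def re complex_eq_iff)
qed

text \<open>The combination of the \<open>x\<^sub>j\<close> is null and lies in the positive definite part.\<close>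

lemma isotropic_combination_eq_0:
  assumes "\<And>i j. i < m \<Longrightarrow> j < m \<Longrightarrow> indef b (x i) (x j) = 1"
    and "(\<Sum>j<m. c j) = 0"
    and "\<And>k. k < b \<Longrightarrow> (\<Sum>j<m. c j * coord (x j) k) = 0"
  shows "(\<Sum>j<m. c j * coord (x j) k) = 0"
proof -
  interpret bounded_bilinear "indef b" by (rule bounded_bilinear_indef)
  define X where "X = (\<Sum>j<m. c j *\<^sub>C x j)"
  have coord_sum: "coord (\<Sum>j\<in>S. y j) k = (\<Sum>j\<in>S. coord (y j) k)" for S y k
    by (induction S rule: infinite_finite_induct) auto
  have coord_X: "coord X k = (\<Sum>j<m. c j * coord (x j) k)" for k
    by (simp add: X_def coord_sum)
  \<comment> \<open>The coordinates that \<open>flip\<close> negates vanish by the third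
    assumption.\<close>
  have "flip b X = X"
    by (rule ell2_eqI) (use assms(3) coord_X in auto)
  \<comment> \<open>As all products are 1, the double sum factors as the squared modulus of the
    coefficient sum.\<close>
  have "indef b X X = (\<Sum>i<m. \<Sum>j<m. c i * cnj (c j) * indef b (x i) (x j))"
    unfolding X_def sum_left sum_right
    by (subst sum.swap) (simp add: indef_scaleC_left indef_scaleC_right mult_ac)
  also have "\<dots> = (\<Sum>i<m. \<Sum>j<m. c i * cnj (c j))"
    using assms(1) by (intro sum.cong refl) auto
  also have "\<dots> = (\<Sum>i<m. c i) * cnj (\<Sum>i<m. c i)"
    by (simp add: sum_product cnj_sum)
  finally have "indef b X X = 0"
    using assms(2) by simp
  then have "X \<bullet> X = 0"
    by (simp add: indef_def cinner_def \<open>flip b X = X\<close> complex_eq_iff)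
  then have "X = 0" by simp
  then show ?thesis
    using coord_X[of k] by simp
qed

section \<open>Holomorphic maps into the sequence space\<close>

lemma norm_vector_smult: "norm (c *s x) = cmod c * norm x" for x :: "complex ^ 'n::finite"
  by (simp add: norm_vec_def L2_set_def norm_mult power_mult_distrib sum_distrib_left[symmetric]
      real_sqrt_mult)

lemma scaleR_eq_smult: "r *\<^sub>R x = complex_of_real r *s x" for x :: "complex ^ 'n::finite"
  by (subst Finite_Cartesian_Product.vec_eq_iff)
    (simp only: vector_scaleR_component vector_smult_component
      scaleR_conv_of_real[where 'a = complex] simp_thms)

lemma bounded_linear_smult_left: "bounded_linear (\<lambda>c. c *s x)" for x :: "complex ^ 'n::finite"
  by (rule bounded_linear_intro[where K = "norm x"])
    (simp_all add: norm_vector_smult vector_sadd_rdistrib scaleR_eq_smult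
      scaleR_conv_of_real[where 'a = complex] vector_smult_assoc)

lemma open_affine_preimage:
  fixes a b :: "complex ^ 'n::finite"
  assumes "open D"
  shows "open {\<zeta>. a + \<zeta> *s b \<in> D}"
proof -
  have "continuous_on UNIV (\<lambda>\<zeta>. a + \<zeta> *s b)"
    by (intro continuous_intros bounded_linear.continuous_on[OF bounded_linear_smult_left])
  then show ?thesis
    using assms by (simp add: continuous_on_open_vimage vimage_def)
qed

text \<open>Chain rule along a complex line: complex linearity reduces the derivative
  \<open>D\<close> to the single vector \<open>D b\<close>.\<close>

lemma holomorphic_ell2_affine:
  assumes "holomorphic_ell2 F V" "a + \<zeta> *s b \<in> V"
  shows "\<exists>G'. ((\<lambda>\<zeta>. F (a + \<zeta> *s b)) has_derivative (\<lambda>h. h *\<^sub>C G')) (at \<zeta>)"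
proof -
  obtain D where D: "(F has_derivative D) (at (a + \<zeta> *s b))" "Vector_Spaces.linear (*s) (*\<^sub>C) D"
    using assms unfolding holomorphic_ell2_def by blast
  have "((\<lambda>\<zeta>. a + \<zeta> *s b) has_derivative (\<lambda>h. 0 + h *s b)) (at \<zeta>)"
    by (intro has_derivative_add has_derivative_const
        bounded_linear.has_derivative[OF bounded_linear_smult_left] has_derivative_ident)
  from has_derivative_compose[OF this D(1)]
  have "((\<lambda>\<zeta>. F (a + \<zeta> *s b)) has_derivative (\<lambda>h. h *\<^sub>C D b)) (at \<zeta>)"
    by (simp add: module_hom.scale[OF D(2)[unfolded linear_iff_module_hom]])
  then show ?thesis ..
qed

lemma bounded_linear_coord: "bounded_linear (\<lambda>x. coord x k)"
  by (rule bounded_linear_intro[where K = 1]) (simp_all add: cmod_coord_le_norm)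

lemma holomorphic_on_coord_affine:
  assumes "holomorphic_ell2 F V" "\<And>\<zeta>. \<zeta> \<in> S \<Longrightarrow> a + \<zeta> *s b \<in> V"
  shows "(\<lambda>\<zeta>. coord (F (a + \<zeta> *s b)) k) holomorphic_on S"
proof -
  have "(\<lambda>\<zeta>. coord (F (a + \<zeta> *s b)) k) field_differentiable (at \<zeta> within S)" if "\<zeta> \<in> S" for \<zeta>
  proof -
    obtain G' where "((\<lambda>\<zeta>. F (a + \<zeta> *s b)) has_derivative (\<lambda>h. h *\<^sub>C G')) (at \<zeta>)"
      using holomorphic_ell2_affine[OF assms(1) assms(2)[OF \<open>\<zeta> \<in> S\<close>]] by blast
    from bounded_linear.has_derivative[OF bounded_linear_coord this, of k]
    have "((\<lambda>\<zeta>. coord (F (a + \<zeta> *s b)) k) has_field_derivative coord G' k) (at \<zeta>)"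
      by (simp add: has_field_derivative_def mult_commute_abs)
    then show ?thesis
      by (meson field_differentiable_at_within field_differentiable_def)
  qed
  then show ?thesis
    by (simp add: holomorphic_on_def)
qed

text \<open>The form is conjugate linear in its second argument, so inserting
  \<open>cnj \<zeta>\<close> there makes the conjugations cancel.\<close>

lemma holomorphic_on_indef:
  assumes G: "\<And>t. t \<in> T \<Longrightarrow> (G has_derivative (\<lambda>h. h *\<^sub>C G' t)) (at t)"
    and "\<And>\<zeta>. \<zeta> \<in> S \<Longrightarrow> \<alpha> * \<zeta> + \<beta> \<in> T" "\<And>\<zeta>. \<zeta> \<in> S \<Longrightarrow> \<gamma> * cnj \<zeta> + \<delta> \<in> T"
  shows "(\<lambda>\<zeta>. indef b (G (\<alpha> * \<zeta> + \<beta>)) (G (\<gamma> * cnj \<zeta> + \<delta>))) holomorphic_on S"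
proof -
  have "(\<lambda>\<zeta>. indef b (G (\<alpha> * \<zeta> + \<beta>)) (G (\<gamma> * cnj \<zeta> + \<delta>))) field_differentiable (at \<zeta> within S)"
    if "\<zeta> \<in> S" for \<zeta>
  proof -
    let ?u = "\<alpha> * \<zeta> + \<beta>" and ?v = "\<gamma> * cnj \<zeta> + \<delta>"
    have u: "((\<lambda>\<zeta>. \<alpha> * \<zeta> + \<beta>) has_derivative (\<lambda>h. \<alpha> * h)) (at \<zeta>)"
      by (auto intro!: derivative_eq_intros)
    have v: "((\<lambda>\<zeta>. \<gamma> * cnj \<zeta> + \<delta>) has_derivative (\<lambda>h. \<gamma> * cnj h)) (at \<zeta>)"
      by (auto intro!: derivative_eq_intros bounded_linear.has_derivative[OF bounded_linear_cnj])
    have "((\<lambda>\<zeta>. G (\<alpha> * \<zeta> + \<beta>)) has_derivative (\<lambda>h. (\<alpha> * h) *\<^sub>C G' ?u)) (at \<zeta>)"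
      using has_derivative_compose[OF u G] assms(2) that by blast
    moreover have "((\<lambda>\<zeta>. G (\<gamma> * cnj \<zeta> + \<delta>)) has_derivative (\<lambda>h. (\<gamma> * cnj h) *\<^sub>C G' ?v)) (at \<zeta>)"
      using has_derivative_compose[OF v G] assms(3) that by blast
    ultimately have "((\<lambda>\<zeta>. indef b (G (\<alpha> * \<zeta> + \<beta>)) (G (\<gamma> * cnj \<zeta> + \<delta>))) has_derivative
        (\<lambda>h. indef b (G ?u) ((\<gamma> * cnj h) *\<^sub>C G' ?v) + indef b ((\<alpha> * h) *\<^sub>C G' ?u) (G ?v))) (at \<zeta>)"
      by (rule bounded_bilinear.FDERIV[OF bounded_bilinear_indef])
    then have "((\<lambda>\<zeta>. indef b (G (\<alpha> * \<zeta> + \<beta>)) (G (\<gamma> * cnj \<zeta> + \<delta>))) has_field_derivative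
        cnj \<gamma> * indef b (G ?u) (G' ?v) + \<alpha> * indef b (G' ?u) (G ?v)) (at \<zeta>)"
      unfolding has_field_derivative_def
      by (rule has_derivative_eq_rhs)
        (simp add: fun_eq_iff indef_scaleC_left indef_scaleC_right algebra_simps)
    then show ?thesis
      by (meson field_differentiable_at_within field_differentiable_def)
  qed
  then show ?thesis
    by (simp add: holomorphic_on_def)
qed

lemma holomorphic_zero_on_reals:
  assumes "f holomorphic_on ball 0 r" "\<And>x. \<bar>x\<bar> < r \<Longrightarrow> f (complex_of_real x) = 0" "z \<in> ball 0 r"
  shows "f z = 0"
proof -
  have "r > 0"
    using assms(3) norm_ge_zero[of z] by (simp del: norm_ge_zero)
  \<comment> \<open>The real axis is connected with more than one point, hence perfect.\<close>
  have "(0 :: complex) islimpt \<real>"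
  proof -
    have "connected (\<real> :: complex set)"
      unfolding Reals_def by (intro connected_continuous_image continuous_intros) auto
    moreover have "(\<real> :: complex set) \<noteq> {x}" for x
      by (metis Reals_0 Reals_1 singletonD zero_neq_one)
    ultimately show ?thesis
      by (intro connected_imp_perfect) auto
  qed
  then have "0 islimpt (\<real> \<inter> ball (0 :: complex) r)"
    by (rule islimpt_Int_eventually) (rule eventually_at_in_open', use \<open>r > 0\<close> in auto)
  moreover have "f y = 0" if "y \<in> \<real> \<inter> ball 0 r" for y
    using that assms(2) by (auto elim!: Reals_cases)
  ultimately show ?thesis
    using analytic_continuation[OF assms(1) open_ball connected_ball, of "\<real> \<inter> ball 0 r" 0 z]
      \<open>r > 0\<close> assms(3) by auto
qed

text \<open>The substitution \<open>t = x + \<i> y\<close>, \<open>cnj s = x - \<i> y\<close> makes the form holomorphic in \<open>x\<close> and \<open>y\<close>,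
  and real \<open>x\<close>, \<open>y\<close> correspond to the diagonal.\<close>

lemma polarization:
  assumes G: "\<And>t. t \<in> ball 0 \<rho> \<Longrightarrow> (G has_derivative (\<lambda>h. h *\<^sub>C G' t)) (at t)"
    and diag: "\<And>t. t \<in> ball 0 \<rho> \<Longrightarrow> indef b (G t) (G t) = 1"
    and "cmod t < \<rho> / 2" "cmod s < \<rho> / 2"
  shows "indef b (G t) (G s) = 1"
proof -
  define K where "K x y = indef b (G (x + \<i> * y)) (G (cnj x + \<i> * cnj y)) - 1" for x y
  \<comment> \<open>Radius \<open>\<rho> / 2\<close> for \<open>x\<close> and \<open>y\<close> keeps
    both arguments of \<open>G\<close> in the disc of radius \<open>\<rho>\<close>.\<close>
  have dom: "x + \<i> * y \<in> ball 0 \<rho>" "cnj x + \<i> * cnj y \<in> ball 0 \<rho>"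
    if "x \<in> ball 0 (\<rho> / 2)" "y \<in> ball 0 (\<rho> / 2)" for x y
    using that norm_triangle_ineq[of x "\<i> * y"] norm_triangle_ineq[of "cnj x" "\<i> * cnj y"]
    by (simp_all add: norm_mult)
  have hol1: "(\<lambda>x. K x y) holomorphic_on ball 0 (\<rho> / 2)" if "y \<in> ball 0 (\<rho> / 2)" for y
    unfolding K_def
    using holomorphic_on_indef[of "ball 0 \<rho>" G G' "ball 0 (\<rho> / 2)" 1 "\<i> * y" 1 "\<i> * cnj y" b, OF G]
      dom[OF _ that]
    by (intro holomorphic_intros) auto
  have hol2: "(\<lambda>y. K x y) holomorphic_on ball 0 (\<rho> / 2)" if "x \<in> ball 0 (\<rho> / 2)" for x
    unfolding K_def
    using holomorphic_on_indef[of "ball 0 \<rho>" G G' "ball 0 (\<rho> / 2)" \<i> x \<i> "cnj x" b, OF G]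
      dom[OF that]
    by (intro holomorphic_intros) (auto simp: add.commute)
  have real: "K (of_real x) (of_real y) = 0" if "\<bar>x\<bar> < \<rho> / 2" "\<bar>y\<bar> < \<rho> / 2" for x y
    using diag[OF dom(1)[of "of_real x" "of_real y"]] that by (simp add: K_def)
  \<comment> \<open>One variable at a time: first \<open>x\<close> leaves the real axis, then
    \<open>y\<close>.\<close>
  have "K x (of_real y) = 0" if "x \<in> ball 0 (\<rho> / 2)" "\<bar>y\<bar> < \<rho> / 2" for x y
    using holomorphic_zero_on_reals[OF hol1[of "of_real y"] _ that(1)] that(2) real by simp
  then have zero: "K x y = 0" if "x \<in> ball 0 (\<rho> / 2)" "y \<in> ball 0 (\<rho> / 2)" for x y
    using holomorphic_zero_on_reals[OF hol2[OF that(1)] _ that(2)] that(1) by simp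
  define x y where "x = (t + cnj s) / 2" and "y = (t - cnj s) / (2 * \<i>)"
  have "x \<in> ball 0 (\<rho> / 2)" "y \<in> ball 0 (\<rho> / 2)"
    using assms(3,4) norm_triangle_ineq[of t "cnj s"] norm_triangle_ineq4[of t "cnj s"]
    by (simp_all add: x_def y_def norm_divide norm_mult)
  moreover have "x + \<i> * y = t" "cnj x + \<i> * cnj y = s"
    by (simp_all add: x_def y_def field_simps)
  ultimately show ?thesis
    using zero[of x y] by (simp add: K_def)
qed

section \<open>Determinantal rank along lines\<close>

locale ell2_map =
  fixes D :: "(complex ^ 'n::finite) set" and F :: "complex ^ 'n \<Rightarrow> ell2"
  assumes open_D: "open D" and convex_D: "convex D" and hol: "holomorphic_ell2 F D"
begin

text \<open>A minor of the matrix with infinitely many rows whose columns are values of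
  \<open>F\<close>; \<open>k\<close> selects the rows.\<close>

definition fminor :: "nat \<Rightarrow> (nat \<Rightarrow> nat) \<Rightarrow> (nat \<Rightarrow> complex ^ 'n) \<Rightarrow> complex" where
  "fminor r k z = minor r (\<lambda>i j. coord (F (z j)) (k i))"

lemma convex_affine_preimage: "convex {\<zeta>. a + \<zeta> *s b \<in> D}"
proof (rule convexI)
  fix x y and u v :: real
  assume *: "x \<in> {\<zeta>. a + \<zeta> *s b \<in> D}" "y \<in> {\<zeta>. a + \<zeta> *s b \<in> D}" "0 \<le> u" "0 \<le> v" "u + v = 1"
  then have "u *\<^sub>R (a + x *s b) + v *\<^sub>R (a + y *s b) \<in> D"
    using convex_D by (auto simp: convex_def)
  moreover have "u *\<^sub>R (a + x *s b) + v *\<^sub>R (a + y *s b)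
      = (u + v) *\<^sub>R a + (u *\<^sub>R x + v *\<^sub>R y) *s b"
    by (simp add: scaleR_eq_smult scaleR_conv_of_real[where 'a = complex] vector_add_ldistrib vector_sadd_rdistrib
        vector_smult_assoc)
  ultimately show "u *\<^sub>R x + v *\<^sub>R y \<in> {\<zeta>. a + \<zeta> *s b \<in> D}"
    using \<open>u + v = 1\<close> by simp
qed

text \<open>All points move affinely with one parameter. The admissible parameters form an
  intersection of convex open sets, so the identity theorem applies; \<open>C\<close> may be thin,
  such as an arc of a circle.\<close>

lemma fminor_affine_eq_0:
  assumes "\<xi> islimpt C" "\<And>j. j < r \<Longrightarrow> a j + \<xi> *s b j \<in> D" "\<And>j. j < r \<Longrightarrow> a j + \<zeta> *s b j \<in> D"
    and "\<And>\<eta>. \<eta> \<in> C \<Longrightarrow> (\<And>j. j < r \<Longrightarrow> a j + \<eta> *s b j \<in> D) \<Longrightarrow> fminor r k (\<lambda>j. a j + \<eta> *s b j) = 0"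
  shows "fminor r k (\<lambda>j. a j + \<zeta> *s b j) = 0"
proof -
  define \<Omega> where "\<Omega> = (\<Inter>j<r. {\<zeta>. a j + \<zeta> *s b j \<in> D})"
  have "open \<Omega>" "connected \<Omega>" "\<xi> \<in> \<Omega>" "\<zeta> \<in> \<Omega>"
    using assms(2,3) open_affine_preimage[OF open_D] convex_affine_preimage
    by (auto simp: \<Omega>_def intro!: convex_connected convex_INT)
  have "(\<lambda>\<zeta>. fminor r k (\<lambda>j. a j + \<zeta> *s b j)) holomorphic_on \<Omega>"
    unfolding fminor_def
    by (intro holomorphic_on_minor holomorphic_on_coord_affine[OF hol]) (auto simp: \<Omega>_def)
  moreover have "\<xi> islimpt (C \<inter> \<Omega>)"
    using \<open>open \<Omega>\<close> \<open>\<xi> \<in> \<Omega>\<close> by (intro islimpt_Int_eventually[OF assms(1)] eventually_at_in_open')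
  ultimately show ?thesis
    using analytic_continuation[of "\<lambda>\<zeta>. fminor r k (\<lambda>j. a j + \<zeta> *s b j)" \<Omega> "C \<inter> \<Omega>" \<xi> \<zeta>]
      \<open>open \<Omega>\<close> \<open>connected \<Omega>\<close> \<open>\<xi> \<in> \<Omega>\<close> \<open>\<zeta> \<in> \<Omega>\<close> assms(4) by (auto simp: \<Omega>_def)
qed

text \<open>Contracting the parameters to \<open>\<eta> * t j\<close> makes them small for
  \<open>\<eta>\<close> near 0; the identity theorem in \<open>\<eta>\<close> then reaches
  \<open>\<eta> = 1\<close>.\<close>

lemma fminor_line_eq_0:
  assumes "p \<in> D" "\<epsilon> > 0"
    and "\<And>t. (\<And>j. j < r \<Longrightarrow> cmod (t j) < \<epsilon>) \<Longrightarrow> (\<And>j. j < r \<Longrightarrow> p + t j *s v \<in> D)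
      \<Longrightarrow> fminor r k (\<lambda>j. p + t j *s v) = 0"
    and "\<And>j. j < r \<Longrightarrow> p + t j *s v \<in> D"
  shows "fminor r k (\<lambda>j. p + t j *s v) = 0"
proof -
  \<comment> \<open>A common bound of the moduli; the summand 1 makes it strict and
    positive.\<close>
  define m where "m = 1 + (\<Sum>j<r. cmod (t j))"
  have "m > 0"
    unfolding m_def by (intro add_pos_nonneg sum_nonneg) auto
  have le: "cmod (t j) < m" if "j < r" for j
    using member_le_sum[of j "{..<r}" "\<lambda>j. cmod (t j)"] that by (simp add: m_def)
  have "fminor r k (\<lambda>j. p + 1 *s (t j *s v)) = 0"
  proof (rule fminor_affine_eq_0[of 0 "ball 0 (\<epsilon> / m)"])
    show "(0 :: complex) islimpt ball 0 (\<epsilon> / m)"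
      using \<open>m > 0\<close> \<open>\<epsilon> > 0\<close> by (simp add: islimpt_ball)
    fix \<eta> assume \<eta>: "\<eta> \<in> ball 0 (\<epsilon> / m)" "\<And>j. j < r \<Longrightarrow> p + \<eta> *s (t j *s v) \<in> D"
    have "cmod (\<eta> * t j) < \<epsilon>" if "j < r" for j
    proof -
      have "cmod \<eta> * cmod (t j) \<le> cmod \<eta> * m"
        using le[OF that] by (intro mult_left_mono) auto
      also have "\<dots> < \<epsilon>"
        using \<eta>(1) \<open>m > 0\<close> by (simp add: field_simps)
      finally show ?thesis by (simp add: norm_mult)
    qed
    then show "fminor r k (\<lambda>j. p + \<eta> *s (t j *s v)) = 0"
      using assms(3)[of "\<lambda>j. \<eta> * t j"] \<eta>(2) by (simp add: vector_smult_assoc)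
  qed (use assms in auto)
  then show ?thesis by simp
qed

lemma fminor_isotropic_line:
  assumes "p \<in> D" and one: "\<And>t. p + t *s v \<in> D \<Longrightarrow> indef b (F (p + t *s v)) (F (p + t *s v)) = 1"
    and "\<And>j. j < b + 2 \<Longrightarrow> p + t j *s v \<in> D"
  shows "fminor (b + 2) k (\<lambda>j. p + t j *s v) = 0"
proof -
  have "0 \<in> {t. p + t *s v \<in> D}"
    using \<open>p \<in> D\<close> by simp
  then obtain \<rho> where \<rho>: "\<rho> > 0" "ball 0 \<rho> \<subseteq> {t. p + t *s v \<in> D}"
    using open_affine_preimage[OF open_D, of p v] unfolding open_contains_ball by blast
  let ?G = "\<lambda>t. F (p + t *s v)"
  have "\<exists>G'. (?G has_derivative (\<lambda>h. h *\<^sub>C G')) (at t)" if "t \<in> ball 0 \<rho>" for t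
    using holomorphic_ell2_affine[OF hol] \<rho>(2) that by blast
  then obtain G' where G': "\<And>t. t \<in> ball 0 \<rho> \<Longrightarrow> (?G has_derivative (\<lambda>h. h *\<^sub>C G' t)) (at t)"
    by metis
  show ?thesis
  proof (rule fminor_line_eq_0[of p "\<rho> / 2"])
    fix t assume t: "\<And>j. j < b + 2 \<Longrightarrow> cmod (t j) < \<rho> / 2" "\<And>j. j < b + 2 \<Longrightarrow> p + t j *s v \<in> D"
    have gram: "indef b (?G (t i)) (?G (t j)) = 1" if "i < b + 2" "j < b + 2" for i j
    proof (rule polarization[OF G'])
      show "indef b (?G \<tau>) (?G \<tau>) = 1" if "\<tau> \<in> ball 0 \<rho>" for \<tau>
        using one \<rho>(2) that by blast
    qed (use t(1) that in blast)+
    \<comment> \<open>There are \<open>b + 1\<close> equations in \<open>b + 2\<close> unknowns; the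
      row of index \<open>b\<close> is constantly 1 and makes the coefficients sum to zero.\<close>
    obtain c where c: "\<exists>j<b + 2. c j \<noteq> 0"
      "\<forall>i<b + 1. (\<Sum>j<b + 2. c j * (if i < b then coord (?G (t j)) i else 1)) = 0"
      using nontrivial_solution[of "b + 1" "b + 2" "\<lambda>i j. if i < b then coord (?G (t j)) i else 1"]
      unfolding add_less_cancel_left by (meson one_less_numeral_iff semiring_norm(76))
    have "(\<Sum>j<b + 2. c j) = 0"
      using c(2)[rule_format, of b] by simp
    moreover have "(\<Sum>j<b + 2. c j * coord (?G (t j)) i) = 0" if "i < b" for i
      using c(2)[rule_format, of i] that by simp
    ultimately have rel: "(\<Sum>j<b + 2. c j * coord (?G (t j)) i) = 0" for i
      using isotropic_combination_eq_0[of "b + 2" b "\<lambda>j. ?G (t j)" c i] gram by blast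
    show "fminor (b + 2) k (\<lambda>j. p + t j *s v) = 0"
      unfolding fminor_def minor_eq_0_iff by (intro exI[of _ c] conjI c(1) allI impI rel)
  qed (use assms \<rho> in auto)
qed

section \<open>Linear relations between the coordinates of the map\<close>

definition comb :: "nat \<Rightarrow> (nat \<Rightarrow> complex) \<Rightarrow> complex ^ 'n \<Rightarrow> complex" where
  "comb M c z = (\<Sum>k<M. c k * coord (F z) k)"

text \<open>Expanding the bordered minors along the last row gives a relation between the values at
  \<open>z 0\<close> to \<open>z r\<close>, with the same cofactors in every coordinate
  \<open>l\<close>. The last coefficient is nonzero, so \<open>F (z r)\<close> is a combination of
  the other values.\<close>

lemma comb_bordered_eq_0:
  assumes "fminor r k z \<noteq> 0" "\<And>l. fminor (Suc r) (k(r := l)) z = 0" "\<And>j. j < r \<Longrightarrow> comb M c (z j) = 0"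
  shows "comb M c (z r) = 0"
proof -
  let ?A = "\<lambda>i j. coord (F (z j)) (k i)"
  obtain C where C: "C r = minor r ?A"
    "\<And>x. minor (Suc r) (\<lambda>i j. if i < r then ?A i j else x j) = (\<Sum>j\<le>r. x j * C j)"
    using minor_Suc_expand by blast
  have "(\<Sum>j\<le>r. coord (F (z j)) l * C j) = 0" for l
  proof -
    have "fminor (Suc r) (k(r := l)) z
        = minor (Suc r) (\<lambda>i j. if i < r then ?A i j else coord (F (z j)) l)"
      unfolding fminor_def by (intro minor_cong) auto
    then show ?thesis
      using assms(2) C(2) by simp
  qed
  then have "0 = (\<Sum>l<M. c l * (\<Sum>j\<le>r. coord (F (z j)) l * C j))"
    by simp
  also have "\<dots> = (\<Sum>j\<le>r. comb M c (z j) * C j)"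
    by (simp add: comb_def sum_distrib_left sum_distrib_right mult.assoc
        sum.swap[of _ "{..r}" "{..<M}"])
  also have "\<dots> = (\<Sum>j\<in>{r}. comb M c (z j) * C j)"
    by (rule sum.mono_neutral_right) (use assms(3) in auto)
  finally show ?thesis
    using assms(1) C(1) by (simp add: fminor_def)
qed

lemma comb_affine_eq_0:
  assumes "open W" "\<xi> \<in> W" "\<And>\<eta>. \<eta> \<in> W \<Longrightarrow> a + \<eta> *s b \<in> D \<and> comb M c (a + \<eta> *s b) = 0"
    and "a + \<zeta> *s b \<in> D"
  shows "comb M c (a + \<zeta> *s b) = 0"
proof (rule analytic_continuation[of "\<lambda>\<zeta>. comb M c (a + \<zeta> *s b)" "{\<zeta>. a + \<zeta> *s b \<in> D}" W \<xi> \<zeta>])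
  show "(\<lambda>\<zeta>. comb M c (a + \<zeta> *s b)) holomorphic_on {\<zeta>. a + \<zeta> *s b \<in> D}"
    unfolding comb_def by (intro holomorphic_intros holomorphic_on_coord_affine[OF hol]) simp
  show "\<xi> islimpt W"
    using assms(1,2) by (simp add: interior_limit_point interior_open)
  show "\<xi> \<in> {\<zeta>. a + \<zeta> *s b \<in> D}" "W \<subseteq> {\<zeta>. a + \<zeta> *s b \<in> D}"
    using assms(2,3) by auto
qed (use assms in \<open>simp_all add: open_affine_preimage[OF open_D] convex_affine_preimage convex_connected\<close>)

text \<open>Annihilators rather than spans are compared, as relations between coordinates propagate by the
  identity theorem.\<close>

definition determining :: "(complex ^ 'n) set \<Rightarrow> (complex ^ 'n) set \<Rightarrow> bool" where
  "determining Z A \<longleftrightarrow> (\<forall>M c. (\<forall>z\<in>Z. comb M c z = 0) \<longrightarrow> (\<forall>x\<in>A. comb M c x = 0))"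

text \<open>Determinantal form of the condition that on each line in direction \<open>v\<close> the
  values of \<open>F\<close> span a space of dimension less than \<open>N\<close>.\<close>

definition line_rank_less :: "nat \<Rightarrow> complex ^ 'n \<Rightarrow> bool" where
  "line_rank_less N v \<longleftrightarrow>
     (\<forall>q\<in>D. \<forall>t k. (\<forall>j<N. q + t j *s v \<in> D) \<longrightarrow> fminor N k (\<lambda>j. q + t j *s v) = 0)"

text \<open>At a nonvanishing minor of maximal size, taken at the points \<open>s + t\<^sub>j v\<close>, the values of \<open>F\<close> on a
  line in direction \<open>v\<close> near \<open>s\<close> are combinations of its values on the slabs through these points.\<close>

lemma finite_determining_slab_step:
  assumes IH: "\<And>q. q \<in> D \<Longrightarrow> \<exists>Z. finite Z \<and> determining Z (D \<inter> {x. x - q \<in> vec.span T})"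
    and line: "line_rank_less N v"
    and "q \<in> D"
  shows "\<exists>Z. finite Z \<and> determining Z (D \<inter> {x. x - q \<in> vec.span (insert v T)})"
proof -
  define A where "A = D \<inter> {x. x - q \<in> vec.span (insert v T)}"
  define P where "P r \<longleftrightarrow> (\<forall>s\<in>A. \<forall>t k. (\<forall>j<r. s + t j *s v \<in> D) \<longrightarrow> fminor r k (\<lambda>j. s + t j *s v) = 0)" for r
  have "P N"
    using line by (simp add: P_def A_def line_rank_less_def)
  have "q \<in> A"
    using \<open>q \<in> D\<close> by (simp add: A_def vec.span_zero)
  then have "\<not> P 0"
    by (auto simp: P_def fminor_def)
  \<comment> \<open>Since \<open>P\<close> fails at 0, where the minor is 1, and holds at
    \<open>N\<close>, there is an \<open>r\<close> such that size \<open>r\<close> admits a nonzero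
    minor and size \<open>Suc r\<close> does not.\<close>
  with \<open>P N\<close> obtain r where "\<not> P r" "P (Suc r)"
    using ex_least_nat_less[of P N] by blast
  then obtain s t k where s: "s \<in> A" "\<And>j. j < r \<Longrightarrow> s + t j *s v \<in> D"
    and nz: "fminor r k (\<lambda>j. s + t j *s v) \<noteq> 0"
    unfolding P_def by blast
  have "\<forall>j\<in>{..<r}. \<exists>Z. finite Z \<and> determining Z (D \<inter> {x. x - (s + t j *s v) \<in> vec.span T})"
    using IH s(2) by simp
  from bchoice[OF this] obtain Z where Z: "\<And>j. j < r \<Longrightarrow> finite (Z j)"
    "\<And>j. j < r \<Longrightarrow> determining (Z j) (D \<inter> {x. x - (s + t j *s v) \<in> vec.span T})"
    by blast
  have "comb M c x = 0" if ann: "\<And>z. z \<in> (\<Union>j<r. Z j) \<Longrightarrow> comb M c z = 0" and "x \<in> A" for M c x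
  proof -
    have "x - s = (x - q) - (s - q)"
      by simp
    also have "\<dots> \<in> vec.span (insert v T)"
      by (rule vec.span_diff) (use \<open>x \<in> A\<close> \<open>s \<in> A\<close> in \<open>simp_all add: A_def\<close>)
    \<comment> \<open>The displacement from \<open>s\<close> to \<open>x\<close> splits into a part
      along \<open>T\<close> and a part along \<open>v\<close>.\<close>
    finally obtain \<tau> where "x - s - \<tau> *s v \<in> vec.span T"
      by (auto simp: vec.span_insert)
    define \<sigma> where "\<sigma> = x - s - \<tau> *s v"
    have \<sigma>: "\<sigma> \<in> vec.span T" "x - s = \<sigma> + \<tau> *s v"
      using \<open>x - s - \<tau> *s v \<in> vec.span T\<close> by (simp_all add: \<sigma>_def)
    define m where "m \<zeta> = fminor r k (\<lambda>j. (s + t j *s v) + \<zeta> *s \<sigma>)" for \<zeta>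
    define \<Omega> where "\<Omega> = (\<Inter>j<r. {\<zeta>. (s + t j *s v) + \<zeta> *s \<sigma> \<in> D})"
    have "open \<Omega>"
      using open_affine_preimage[OF open_D] by (auto simp: \<Omega>_def)
    moreover have "continuous_on \<Omega> m"
      unfolding m_def fminor_def
      by (intro holomorphic_on_imp_continuous_on holomorphic_on_minor holomorphic_on_coord_affine[OF hol])
        (auto simp: \<Omega>_def)
    ultimately have "open (\<Omega> \<inter> m -` (- {0}))"
      by (intro continuous_open_preimage) auto
    \<comment> \<open>Parameters at which the shift by \<open>\<zeta> *s \<sigma>\<close> keeps the
      minor nonzero and all points in \<open>D\<close>; 0 is one of them.\<close>
    define W where "W = \<Omega> \<inter> m -` (- {0}) \<inter> {\<zeta>. s + \<zeta> *s \<sigma> \<in> D} \<inter> {\<zeta>. s + \<zeta> *s (x - s) \<in> D}"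
    have "open W"
      unfolding W_def
      by (rule open_Int[OF open_Int[OF \<open>open (\<Omega> \<inter> m -` (- {0}))\<close>]]) (rule open_affine_preimage[OF open_D])+
    have "s \<in> D"
      using \<open>s \<in> A\<close> by (simp add: A_def)
    have "0 \<in> W"
      using nz s(2) \<open>s \<in> D\<close> by (auto simp: W_def \<Omega>_def m_def)
    have "comb M c (s + \<zeta> *s (x - s)) = 0" if "\<zeta> \<in> W" for \<zeta>
    proof -
      \<comment> \<open>The base point moves by \<open>\<zeta> *s \<sigma>\<close>, and index
        \<open>r\<close> gets the parameter that puts the last point at
        \<open>s + \<zeta> *s (x - s)\<close>.\<close>
      define s' where "s' = s + \<zeta> *s \<sigma>"
      define t' where "t' j = (if j < r then t j else \<zeta> * \<tau>)" for j
      define z where "z j = s' + t' j *s v" for j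
      have z_less: "z j = (s + t j *s v) + \<zeta> *s \<sigma>" if "j < r" for j
        using that by (simp add: z_def s'_def t'_def)
      have z_r: "z r = s + \<zeta> *s (x - s)"
        by (simp add: z_def s'_def t'_def \<sigma>(2) vector_add_ldistrib vector_smult_assoc add.assoc)
      have zD: "z j \<in> D" if "j \<le> r" for j
        using \<open>\<zeta> \<in> W\<close> that z_less[of j] z_r by (cases "j = r") (auto simp: W_def \<Omega>_def)
      have "s' - q = (s - q) + \<zeta> *s \<sigma>"
        by (simp add: s'_def)
      also have "\<dots> \<in> vec.span (insert v T)"
      proof (rule vec.span_add)
        show "s - q \<in> vec.span (insert v T)"
          using \<open>s \<in> A\<close> by (simp add: A_def)
        show "\<zeta> *s \<sigma> \<in> vec.span (insert v T)"
          using \<sigma>(1) vec.span_mono[of T "insert v T"] by (intro vec.span_scale) auto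
      qed
      finally have "s' \<in> A"
        using \<open>\<zeta> \<in> W\<close> by (simp add: A_def W_def s'_def)
      have "comb M c (z r) = 0"
      proof (rule comb_bordered_eq_0)
        have "fminor r k z = m \<zeta>"
          unfolding fminor_def m_def by (intro minor_cong) (simp add: z_less)
        then show "fminor r k z \<noteq> 0"
          using \<open>\<zeta> \<in> W\<close> by (simp add: W_def)
        show "fminor (Suc r) (k(r := l)) z = 0" for l
          using \<open>P (Suc r)\<close> \<open>s' \<in> A\<close> zD unfolding P_def z_def by (auto simp: less_Suc_eq_le)
        \<comment> \<open>The shift lies in the span of \<open>T\<close>, so the point stays in the
          slab determined by \<open>Z j\<close>.\<close>
        fix j assume "j < r"
        then have "z j \<in> D \<inter> {x. x - (s + t j *s v) \<in> vec.span T}"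
          using zD[of j] vec.span_scale[OF \<sigma>(1)] by (simp add: z_less)
        then show "comb M c (z j) = 0"
          using Z(2)[OF \<open>j < r\<close>] ann \<open>j < r\<close> unfolding determining_def by blast
      qed
      then show ?thesis
        by (simp add: z_r)
    qed
    \<comment> \<open>The identity theorem leads from \<open>W\<close> to the parameter 1, where the
      point is \<open>x\<close>.\<close>
    then have "comb M c (s + 1 *s (x - s)) = 0"
      using \<open>open W\<close> \<open>0 \<in> W\<close> \<open>x \<in> A\<close>
      by (intro comb_affine_eq_0[of W 0]) (auto simp: W_def A_def)
    then show ?thesis by simp
  qed
  then have "determining (\<Union>j<r. Z j) A"
    unfolding determining_def by blast
  then show ?thesis
    using Z(1) unfolding A_def by (intro exI[of _ "\<Union>j<r. Z j"]) auto
qed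

text \<open>Directions are added one at a time, starting from the slab consisting of
  \<open>q\<close> alone.\<close>

lemma finite_determining_slab:
  assumes "finite T"
    and "\<forall>v\<in>T. line_rank_less N v"
    and "q \<in> D"
  shows "\<exists>Z. finite Z \<and> determining Z (D \<inter> {x. x - q \<in> vec.span T})"
  using assms
proof (induction T arbitrary: q rule: finite_induct)
  case empty
  then show ?case
    by (intro exI[of _ "{q}"]) (auto simp: determining_def)
next
  case (insert v T)
  show ?case
  proof (rule finite_determining_slab_step[where N = N])
    show "\<exists>Z. finite Z \<and> determining Z (D \<inter> {x. x - q \<in> vec.span T})" if "q \<in> D" for q
      using insert.IH insert.prems(1) that by blast
    show "line_rank_less N v"
      using insert.prems(1) by blast
  qed (rule insert.prems(2))
qed

text \<open>As \<open>T\<close> spans, the slab is all of \<open>D\<close>. Its \<open>n\<close>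
  determining points impose \<open>n\<close> equations on \<open>Suc n\<close> coefficients.\<close>

lemma linear_relation_of_rank_bound:
  assumes "finite T" "vec.span T = UNIV" "D \<noteq> {}"
    and "\<forall>v\<in>T. line_rank_less N v"
  shows "\<exists>M c. (\<exists>k<M. c k \<noteq> 0) \<and> (\<forall>x\<in>D. (\<Sum>k<M. c k * coord (F x) k) = 0)"
proof -
  obtain q where "q \<in> D"
    using assms(3) by blast
  obtain Z where Z: "finite Z" "determining Z D"
    using finite_determining_slab[OF assms(1,4) \<open>q \<in> D\<close>] unfolding assms(2) by auto
  obtain z :: "nat \<Rightarrow> complex ^ 'n" and n where z: "Z = z ` {..<n}"
    using Z(1) by (metis finite_conv_nat_seg_image lessThan_def)
  obtain c where c: "\<exists>k<Suc n. c k \<noteq> 0" "\<forall>i<n. comb (Suc n) c (z i) = 0"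
    using nontrivial_solution[OF lessI, of n "\<lambda>i k. coord (F (z i)) k"]
    unfolding comb_def by blast
  have "\<forall>w\<in>Z. comb (Suc n) c w = 0"
    using c(2) by (simp add: z)
  then have "\<forall>x\<in>D. comb (Suc n) c x = 0"
    using Z(2) unfolding determining_def by blast
  with c(1) show ?thesis
    unfolding comb_def by blast
qed

end

section \<open>Lines and the quadric\<close>

definition herm :: "complex ^ ('a::finite + 'b::finite) \<Rightarrow> complex ^ ('a + 'b) \<Rightarrow> complex" where
  "herm x y = (\<Sum>j\<in>UNIV. x $ Inl j * cnj (y $ Inl j)) - (\<Sum>j\<in>UNIV. x $ Inr j * cnj (y $ Inr j))"

lemma herm_commute: "herm y x = cnj (herm x y)"
  by (simp add: herm_def cnj_sum mult.commute)

lemma herm_add_left: "herm (x + x') y = herm x y + herm x' y"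
  by (simp add: herm_def sum.distrib distrib_right)

lemma herm_scale_left: "herm (c *s x) y = c * herm x y"
  by (simp add: herm_def sum_distrib_left right_diff_distrib mult.assoc)

lemma herm_diff_left: "herm (x - x') y = herm x y - herm x' y"
  by (simp add: herm_def sum_subtractf left_diff_distrib)

lemma herm_add_right: "herm x (y + y') = herm x y + herm x y'"
  by (metis herm_commute herm_add_left complex_cnj_add)

lemma herm_scale_right: "herm x (c *s y) = cnj c * herm x y"
  by (metis herm_commute herm_scale_left complex_cnj_mult)

lemma herm_diff_right: "herm x (y - y') = herm x y - herm x y'"
  by (metis herm_commute herm_diff_left complex_cnj_diff)

lemmas herm_linear = herm_add_left herm_add_right herm_diff_left herm_diff_right
  herm_scale_left herm_scale_right

lemma herm_self: "herm x x = of_real (Re (herm x x))"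
  using herm_commute[of x x] by (metis complex_eq_cancel_iff2 complex_is_Real_iff of_real_Re Reals_cnj_iff)

lemma Q_fin_iff: "z \<in> Q_fin \<longleftrightarrow> herm z z = 1"
proof -
  have "herm z z = of_real ((\<Sum>j\<in>UNIV. (cmod (z $ Inl j))\<^sup>2) - (\<Sum>j\<in>UNIV. (cmod (z $ Inr j))\<^sup>2))"
    by (simp add: herm_def complex_norm_square del: of_real_power)
  then show ?thesis
    by (simp only: Q_fin_def mem_Collect_eq of_real_eq_1_iff)
qed

lemma herm_axis_Inl: "herm (axis (Inl i) 1) w = cnj (w $ Inl i)"
proof -
  have "(\<Sum>j\<in>UNIV. axis (Inl i) 1 $ Inl j * cnj (w $ Inl j)) = (\<Sum>j\<in>{i}. cnj (w $ Inl j))"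
    by (rule sum.mono_neutral_cong_right) (auto simp: axis_def)
  then show ?thesis
    by (simp add: herm_def axis_def)
qed

lemma herm_axis_Inr: "herm (axis (Inr i) 1) w = - cnj (w $ Inr i)"
proof -
  have "(\<Sum>j\<in>UNIV. axis (Inr i) 1 $ Inr j * cnj (w $ Inr j)) = (\<Sum>j\<in>{i}. cnj (w $ Inr j))"
    by (rule sum.mono_neutral_cong_right) (auto simp: axis_def)
  then show ?thesis
    by (simp add: herm_def axis_def)
qed

lemma bounded_bilinear_smult: "bounded_bilinear (\<lambda>c (x :: complex ^ 'n::finite). c *s x)"
proof
  show "\<exists>K. \<forall>c (x :: complex ^ 'n). norm (c *s x) \<le> norm c * norm x * K"
    by (intro exI[of _ 1]) (simp add: norm_vector_smult)
qed (simp_all add: vector_add_ldistrib vector_sadd_rdistrib scaleR_eq_smult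
    scaleR_conv_of_real[where 'a = complex] vector_smult_assoc mult.commute)

text \<open>The plane of two positive axes contains a nonzero vector orthogonal to \<open>q\<close>.
  Projecting it off the negative \<open>v\<close> keeps its square positive, and scaling adjusts the
  value.\<close>

lemma exists_orthogonal_of_opposite_sign:
  fixes v q :: "complex ^ ('a::finite + 'b::finite)"
  assumes "CARD('a) \<ge> 2" "Re (herm v v) < 0" "herm v q = 0"
  shows "\<exists>y. herm y v = 0 \<and> herm y q = 0 \<and> herm y y = - herm v v"
proof -
  obtain i j :: 'a where "i \<noteq> j"
    using assms(1) by (metis card_2_iff' ex_card UNIV_I subset_UNIV)
  \<comment> \<open>Orthogonality to \<open>q\<close> is one linear equation in two
    unknowns.\<close>
  obtain s t where st: "s * cnj (q $ Inl i) + t * cnj (q $ Inl j) = 0" "s \<noteq> 0 \<or> t \<noteq> 0"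
  proof (cases "q $ Inl i = 0")
    case True
    then show ?thesis
      using that[of 1 0] by simp
  next
    case False
    then show ?thesis
      using that[of "cnj (q $ Inl j)" "- cnj (q $ Inl i)"] by simp
  qed
  define x where "x = s *s axis (Inl i) 1 + t *s (axis (Inl j) 1 :: complex ^ ('a + 'b))"
  have "herm x w = s * cnj (w $ Inl i) + t * cnj (w $ Inl j)" for w
    by (simp add: x_def herm_linear herm_axis_Inl)
  moreover have "x $ Inl i = s" "x $ Inl j = t"
    using \<open>i \<noteq> j\<close> by (simp_all add: x_def axis_def)
  ultimately have "herm x q = 0" and xx: "herm x x = of_real ((cmod s)\<^sup>2 + (cmod t)\<^sup>2)"
    using st(1) by (simp_all add: complex_norm_square del: of_real_power)
  define a where "a = Re (herm v v)"
  have vv: "herm v v = of_real a" "a < 0"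
    using assms(2) by (simp_all add: a_def herm_self[symmetric])
  \<comment> \<open>Orthogonality to \<open>q\<close> survives the projection because
    \<open>v\<close> is orthogonal to \<open>q\<close>.\<close>
  define y where "y = x - (herm x v / herm v v) *s v"
  have yv: "herm y v = 0" and yq: "herm y q = 0"
    using vv assms(3) \<open>herm x q = 0\<close> by (simp_all add: y_def herm_linear)
  have "herm y y = herm x x - (herm x v / herm v v) * herm v x"
    using yv by (subst (2) y_def) (simp add: herm_linear, simp add: y_def herm_linear)
  also have "herm v x = cnj (herm x v)"
    by (rule herm_commute)
  also have "(herm x v / herm v v) * cnj (herm x v) = of_real ((cmod (herm x v))\<^sup>2 / a)"
    by (simp add: vv(1) complex_norm_square del: of_real_power)
  finally have yy: "herm y y = of_real ((cmod s)\<^sup>2 + (cmod t)\<^sup>2 - (cmod (herm x v))\<^sup>2 / a)"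
    by (simp add: xx)
  define d where "d = (cmod s)\<^sup>2 + (cmod t)\<^sup>2 - (cmod (herm x v))\<^sup>2 / a"
  have "d > 0"
  proof -
    have "(cmod s)\<^sup>2 + (cmod t)\<^sup>2 > 0"
      using st(2) by (auto intro: add_pos_nonneg add_nonneg_pos)
    moreover have "(cmod (herm x v))\<^sup>2 / a \<le> 0"
      using vv(2) by (simp add: divide_nonneg_neg)
    ultimately show ?thesis by (simp add: d_def)
  qed
  define l where "l = sqrt (- a / d)"
  have "l * l * d = - a"
    using \<open>d > 0\<close> vv(2) by (simp add: l_def)
  then have "complex_of_real l * (of_real l * of_real d) = - of_real a"
    by (metis of_real_minus of_real_mult mult.assoc)
  then have "herm (of_real l *s y) (of_real l *s y) = - herm v v"
    by (simp add: herm_linear yy vv(1) flip: d_def)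
  then show ?thesis
    using yv yq by (intro exI[of _ "of_real l *s y"]) (simp add: herm_linear)
qed

section \<open>Vanishing minors on lines near the quadric\<close>

text \<open>Here \<open>b\<close> is the finite value of \<open>B\<close>, not the number of
  negative directions of the source.\<close>

locale quadric_map = ell2_map D F
  for D :: "(complex ^ ('a::finite + 'b::finite)) set" and F +
  fixes b :: nat
  assumes two_positive: "CARD('a) \<ge> 2"
    and unit: "\<And>z. z \<in> D \<Longrightarrow> herm z z = 1 \<Longrightarrow> indef b (F z) (F z) = 1"
begin

lemma one_islimpt_circle: "(1 :: complex) islimpt sphere 0 1"
proof (rule connected_imp_perfect)
  show "sphere 0 1 \<noteq> {x}" for x :: complex
  proof -
    have "1 \<in> sphere (0 :: complex) 1" "-1 \<in> sphere (0 :: complex) 1" "(1 :: complex) \<noteq> -1"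
      by auto
    then show ?thesis by (metis singletonD)
  qed
qed (auto intro: connected_sphere)

text \<open>The directions \<open>v + \<eta> y\<close> with \<open>\<bar>\<eta>\<bar> = 1\<close> are isotropic, and \<open>v\<close> is their value at \<open>\<eta> = 0\<close>.\<close>

lemma fminor_tangent_line:
  assumes "p \<in> D" "herm p p = 1" "herm v p = 0" "Re (herm v v) < 0"
    and "\<And>j. j < b + 2 \<Longrightarrow> p + t j *s v \<in> D"
  shows "fminor (b + 2) k (\<lambda>j. p + t j *s v) = 0"
proof -
  obtain y where y: "herm y v = 0" "herm y p = 0" "herm y y = - herm v v"
    using exists_orthogonal_of_opposite_sign[OF two_positive assms(4,3)] by blast
  obtain r where r: "r > 0" "ball p r \<subseteq> D"
    using open_D \<open>p \<in> D\<close> open_contains_ball by blast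
  have pos: "norm v + norm y + 1 > 0"
    by (intro add_nonneg_pos add_nonneg_nonneg) auto
  show ?thesis
  proof (rule fminor_line_eq_0[of p "r / (norm v + norm y + 1)"])
    fix t assume t: "\<And>j. j < b + 2 \<Longrightarrow> cmod (t j) < r / (norm v + norm y + 1)"
      and tD: "\<And>j. j < b + 2 \<Longrightarrow> p + t j *s v \<in> D"
    \<comment> \<open>For fixed \<open>t\<close> the minor vanishes for \<open>\<eta>\<close> on the
      unit circle near 1; the identity theorem moves \<open>\<eta>\<close> to the centre 0.\<close>
    have "fminor (b + 2) k (\<lambda>j. (p + t j *s v) + 0 *s (t j *s y)) = 0"
    proof (rule fminor_affine_eq_0[OF one_islimpt_circle])
      show "p + t j *s v + 1 *s (t j *s y) \<in> D" if "j < b + 2" for j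
      proof -
        have "norm (t j *s v + t j *s y) \<le> cmod (t j) * norm v + cmod (t j) * norm y"
          using norm_triangle_ineq[of "t j *s v" "t j *s y"] by (simp add: norm_vector_smult)
        also have "\<dots> \<le> cmod (t j) * (norm v + norm y + 1)"
          by (simp add: distrib_left)
        also have "\<dots> < r"
          using t[OF that] pos by (simp add: pos_less_divide_eq)
        finally have "p + (t j *s v + t j *s y) \<in> ball p r"
          by (subst mem_ball, subst dist_commute) (simp add: dist_norm)
        then show ?thesis
          using r(2) by (auto simp: add.assoc)
      qed
      fix \<eta> assume "\<eta> \<in> sphere (0 :: complex) 1"
        and \<eta>D: "\<And>j. j < b + 2 \<Longrightarrow> p + t j *s v + \<eta> *s (t j *s y) \<in> D"
      have "\<eta> * cnj \<eta> = 1"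
        using \<open>\<eta> \<in> sphere 0 1\<close> by (simp add: complex_norm_square[symmetric])
      define w where "w = v + \<eta> *s y"
      have "herm v y = 0"
        using y(1) herm_commute[of v y] by simp
      \<comment> \<open>The cross terms vanish, and \<open>\<eta> * cnj \<eta> = 1\<close> lets the
        squares of \<open>v\<close> and \<open>y\<close> cancel.\<close>
      then have "herm w w = 0"
        using y \<open>\<eta> * cnj \<eta> = 1\<close> by (simp add: w_def herm_linear mult.commute[of "cnj \<eta>"])
      moreover have "herm w p = 0"
        using y(2) assms(3) by (simp add: w_def herm_linear)
      moreover from this have "herm p w = 0"
        using herm_commute[of p w] by simp
      \<comment> \<open>A null vector orthogonal to \<open>p\<close> spans a line through
        \<open>p\<close> inside the quadric.\<close>
      ultimately have "herm (p + \<tau> *s w) (p + \<tau> *s w) = 1" for \<tau>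
        using assms(2) by (simp add: herm_linear)
      then have one: "indef b (F (p + \<tau> *s w)) (F (p + \<tau> *s w)) = 1" if "p + \<tau> *s w \<in> D" for \<tau>
        using unit that by blast
      have eq: "p + t j *s v + \<eta> *s (t j *s y) = p + t j *s w" for j
        by (simp add: w_def vector_add_ldistrib vector_smult_assoc mult.commute add.assoc)
      show "fminor (b + 2) k (\<lambda>j. p + t j *s v + \<eta> *s (t j *s y)) = 0"
        unfolding eq by (rule fminor_isotropic_line[OF assms(1) one]) (assumption, rule \<eta>D[unfolded eq])
    qed (use tD in simp)
    then show "fminor (b + 2) k (\<lambda>j. p + t j *s v) = 0"
      by simp
  qed (use assms r(1) pos in auto)
qed

text \<open>The points \<open>\<eta> p\<close> with \<open>\<bar>\<eta>\<bar> = 1\<close> lie on the quadric.\<close>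

lemma fminor_orthogonal_line:
  assumes "p \<in> D" "herm p p = 1" "\<zeta> *s p \<in> D" "herm v p = 0" "Re (herm v v) < 0"
    and "\<And>j. j < b + 2 \<Longrightarrow> \<zeta> *s p + t j *s v \<in> D"
  shows "fminor (b + 2) k (\<lambda>j. \<zeta> *s p + t j *s v) = 0"
proof -
  obtain r where r: "r > 0" "ball p r \<subseteq> D"
    using open_D \<open>p \<in> D\<close> open_contains_ball by blast
  have pos: "norm v + 1 > 0"
    by (intro add_nonneg_pos) auto
  show ?thesis
  proof (rule fminor_line_eq_0[of "\<zeta> *s p" "r / (norm v + 1)"])
    fix t assume t: "\<And>j. j < b + 2 \<Longrightarrow> cmod (t j) < r / (norm v + 1)"
      and tD: "\<And>j. j < b + 2 \<Longrightarrow> \<zeta> *s p + t j *s v \<in> D"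
    \<comment> \<open>The tangent case applies to the points \<open>\<eta> *s p\<close> of
      \<open>D\<close> on the unit circle, and the identity theorem continues from there to
      \<open>\<zeta>\<close>.\<close>
    have "fminor (b + 2) k (\<lambda>j. t j *s v + \<zeta> *s p) = 0"
    proof (rule fminor_affine_eq_0[of 1 "sphere 0 1 \<inter> {\<eta>. 0 + \<eta> *s p \<in> D}"])
      show "1 islimpt (sphere 0 1 \<inter> {\<eta>. 0 + \<eta> *s p \<in> D})"
      proof (rule islimpt_Int_eventually[OF one_islimpt_circle])
        show "\<forall>\<^sub>F \<eta> in at 1. \<eta> \<in> {\<eta>. 0 + \<eta> *s p \<in> D}"
          by (rule eventually_at_in_open'[OF open_affine_preimage[OF open_D]]) (use assms(1) in simp)
      qed
      show "t j *s v + 1 *s p \<in> D" if "j < b + 2" for j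
      proof -
        have "norm (t j *s v) \<le> cmod (t j) * (norm v + 1)"
          by (simp add: norm_vector_smult distrib_left)
        also have "\<dots> < r"
          using t[OF that] pos by (simp add: pos_less_divide_eq)
        finally show ?thesis
          using r(2) by (auto simp: dist_norm)
      qed
      show "t j *s v + \<zeta> *s p \<in> D" if "j < b + 2" for j
        using tD[OF that] by (simp add: add.commute)
      fix \<eta> assume \<eta>: "\<eta> \<in> sphere 0 1 \<inter> {\<eta>. 0 + \<eta> *s p \<in> D}"
        and \<eta>D: "\<And>j. j < b + 2 \<Longrightarrow> t j *s v + \<eta> *s p \<in> D"
      have "\<eta> * cnj \<eta> = 1"
        using \<eta> by (simp add: complex_norm_square[symmetric])
      then have "herm (\<eta> *s p) (\<eta> *s p) = 1"
        by (simp add: herm_linear assms(2) mult.commute[of "cnj \<eta>"])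
      moreover have "herm v (\<eta> *s p) = 0"
        by (simp add: herm_linear assms(4))
      ultimately have "fminor (b + 2) k (\<lambda>j. \<eta> *s p + t j *s v) = 0"
        by (intro fminor_tangent_line assms(5)) (use \<eta> \<eta>D in \<open>simp_all add: add.commute\<close>)
      then show "fminor (b + 2) k (\<lambda>j. t j *s v + \<eta> *s p) = 0"
        by (simp add: add.commute)
    qed
    then show "fminor (b + 2) k (\<lambda>j. \<zeta> *s p + t j *s v) = 0"
      by (simp add: add.commute)
  qed (use assms r(1) pos in auto)
qed

text \<open>\<open>foot q v\<close> is the point of the line through \<open>q\<close> in direction \<open>v\<close> that is orthogonal to \<open>v\<close>.\<close>

definition foot :: "complex ^ ('a + 'b) \<Rightarrow> complex ^ ('a + 'b) \<Rightarrow> complex ^ ('a + 'b)" where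
  "foot q v = q - (herm q v / herm v v) *s v"

text \<open>Open conditions that bring a line under \<open>fminor_orthogonal_line\<close>: the foot
  is a positive multiple of a quadric point in \<open>D\<close>, and the direction is
  negative.\<close>

definition good :: "complex ^ ('a + 'b) \<Rightarrow> complex ^ ('a + 'b) \<Rightarrow> bool" where
  "good q v \<longleftrightarrow> Re (herm v v) < 0 \<and> foot q v \<in> D \<and> Re (herm (foot q v) (foot q v)) > 0
     \<and> of_real (1 / sqrt (Re (herm (foot q v) (foot q v)))) *s foot q v \<in> D"

lemma fminor_good_line:
  assumes "good q v" "\<And>j. j < b + 2 \<Longrightarrow> q + t j *s v \<in> D"
  shows "fminor (b + 2) k (\<lambda>j. q + t j *s v) = 0"
proof -
  define s where "s = sqrt (Re (herm (foot q v) (foot q v)))"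
  define p where "p = complex_of_real (1 / s) *s foot q v"
  define c where "c = herm q v / herm v v"
  have "s > 0" and s2: "s * s = Re (herm (foot q v) (foot q v))" and "p \<in> D" "foot q v \<in> D"
    and neg: "Re (herm v v) < 0"
    using assms(1) by (simp_all add: good_def s_def p_def)
  have foot: "foot q v = of_real s *s p"
    using \<open>s > 0\<close> by (simp add: p_def vector_smult_assoc)
  have "herm (foot q v) (foot q v) = of_real (s * s)"
    unfolding s2 by (rule herm_self)
  then have "herm p p = 1"
    using \<open>s > 0\<close> by (simp add: p_def herm_linear)
  have "herm v v \<noteq> 0"
    using neg by auto
  then have "herm (foot q v) v = 0"
    by (simp add: foot_def herm_linear)
  then have "herm v (foot q v) = 0"
    using herm_commute[of v "foot q v"] by simp
  then have "herm v p = 0"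
    by (simp add: p_def herm_linear)
  \<comment> \<open>The same line measured from its foot, with the parameter shifted by
    \<open>c\<close>.\<close>
  have eq: "q + t j *s v = of_real s *s p + (t j + c) *s v" for j
    unfolding foot[symmetric] by (simp add: foot_def c_def vector_sadd_rdistrib)
  show ?thesis
    unfolding eq
    by (rule fminor_orthogonal_line[OF \<open>p \<in> D\<close> \<open>herm p p = 1\<close> _ \<open>herm v p = 0\<close> neg])
      (use \<open>foot q v \<in> D\<close> foot assms(2) eq in auto)
qed

text \<open>At \<open>q = p\<close> and \<open>w = v\<close> the foot is \<open>p\<close> itself, of
  square 1. The foot varies continuously with the line, so the conditions persist nearby.\<close>

lemma eventually_good:
  assumes "p \<in> D" "herm p p = 1" "herm v p = 0" "Re (herm v v) < 0"
  shows "\<exists>\<eta>>0. \<forall>q\<in>ball p \<eta>. \<forall>w\<in>ball v \<eta>. good q w"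
proof -
  let ?N = "nhds p \<times>\<^sub>F nhds v"
  note fst = filterlim_fst[of "nhds p" "nhds v"] and snd = filterlim_snd[of "nhds v" "nhds p"]
  note smult = bounded_bilinear.tendsto[OF bounded_bilinear_smult]
  have herm: "((\<lambda>z. herm (f z) (g z)) \<longlongrightarrow> herm x y) ?N"
    if "(f \<longlongrightarrow> x) ?N" "(g \<longlongrightarrow> y) ?N" for f g x y
    unfolding herm_def by (intro tendsto_intros that)
  have "herm p v = 0"
    using assms(3) herm_commute[of p v] by simp
  have "((\<lambda>z. fst z - (herm (fst z) (snd z) / herm (snd z) (snd z)) *s snd z)
      \<longlongrightarrow> p - (herm p v / herm v v) *s v) ?N"
    using assms(4) by (intro tendsto_diff smult tendsto_divide herm fst snd) auto
  then have foot: "((\<lambda>z. foot (fst z) (snd z)) \<longlongrightarrow> p) ?N"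
    by (simp add: foot_def \<open>herm p v = 0\<close>)
  have neg: "\<forall>\<^sub>F z in ?N. Re (herm (snd z) (snd z)) < 0"
    using tendsto_Re[OF herm[OF snd snd]] assms(4) by (rule order_tendstoD(2))
  have inD: "\<forall>\<^sub>F z in ?N. foot (fst z) (snd z) \<in> D"
    using foot open_D \<open>p \<in> D\<close> by (rule topological_tendstoD)
  let ?m = "\<lambda>z. Re (herm (foot (fst z) (snd z)) (foot (fst z) (snd z)))"
  have m: "(?m \<longlongrightarrow> 1) ?N"
    using tendsto_Re[OF herm[OF foot foot]] by (simp add: assms(2))
  then have pos: "\<forall>\<^sub>F z in ?N. ?m z > 0"
    by (rule order_tendstoD(1)) simp
  have "((\<lambda>z. complex_of_real (1 / sqrt (?m z)) *s foot (fst z) (snd z))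
      \<longlongrightarrow> of_real (1 / sqrt 1) *s p) ?N"
    by (intro smult foot tendsto_of_real tendsto_divide tendsto_real_sqrt m tendsto_const) simp
  then have "\<forall>\<^sub>F z in ?N. complex_of_real (1 / sqrt (?m z)) *s foot (fst z) (snd z) \<in> D"
    by (rule topological_tendstoD[OF _ open_D]) (simp add: \<open>p \<in> D\<close>)
  then have "\<forall>\<^sub>F z in ?N. good (fst z) (snd z)"
    using neg inD pos by eventually_elim (simp add: good_def)
  then obtain P R where "eventually P (nhds p)" "eventually R (nhds v)"
    "\<And>q w. P q \<Longrightarrow> R w \<Longrightarrow> good q w"
    by (auto simp: eventually_prod_filter)
  moreover from this obtain e d where "e > 0" "\<And>q. dist q p < e \<Longrightarrow> P q" "d > 0" "\<And>w. dist w v < d \<Longrightarrow> R w"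
    unfolding eventually_nhds_metric by blast
  ultimately show ?thesis
    by (intro exI[of _ "min e d"]) (auto simp: dist_commute)
qed

end

section \<open>Propagation to the connected set\<close>

text \<open>Projecting a negative axis vector \<open>e\<close> off \<open>p\<close>, whose square is
  1, lowers the square of \<open>e\<close> from -1 by
  \<open>(cmod (herm e p))\<^sup>2\<close>.\<close>

lemma exists_tangent_negative:
  fixes p :: "complex ^ ('a::finite + 'b::finite)"
  assumes "herm p p = 1"
  shows "\<exists>v. herm v p = 0 \<and> Re (herm v v) < 0"
proof -
  define e where "e = (axis (Inr undefined) 1 :: complex ^ ('a + 'b))"
  have ee: "herm e e = - 1"
    by (simp add: e_def herm_axis_Inr)
  define v where "v = e - herm e p *s p"
  have vp: "herm v p = 0"
    by (simp add: v_def herm_linear assms)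
  have "herm v v = herm v e - cnj (herm e p) * herm v p"
    by (subst (2) v_def) (simp add: herm_linear)
  also have "\<dots> = - 1 - herm e p * cnj (herm e p)"
    by (simp add: vp) (simp add: v_def herm_linear ee herm_commute[of p e])
  also have "\<dots> = of_real (- 1 - (cmod (herm e p))\<^sup>2)"
    by (simp add: complex_norm_square del: of_real_power)
  finally have "Re (herm v v) = - 1 - (cmod (herm e p))\<^sup>2"
    by simp
  then have "Re (herm v v) < 0"
    using zero_le_power2[of "cmod (herm e p)"] by linarith
  with vp show ?thesis by blast
qed

text \<open>This provides spanning directions arbitrarily close to \<open>v\<close>: their
  differences from \<open>v\<close> are multiples of the axes.\<close>

lemma span_perturbed_axes:
  fixes v :: "complex ^ 'n::finite"
  assumes "\<delta> \<noteq> 0"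
  shows "vec.span (insert v (range (\<lambda>l. v + \<delta> *s axis l 1))) = UNIV" (is "vec.span ?T = UNIV")
proof -
  have "axis l 1 \<in> vec.span ?T" for l
  proof -
    have "(v + \<delta> *s axis l 1) - v \<in> vec.span ?T"
      by (intro vec.span_diff vec.span_base) auto
    then have "\<delta> *s axis l 1 \<in> vec.span ?T"
      by simp
    then have "(1 / \<delta>) *s (\<delta> *s axis l 1) \<in> vec.span ?T"
      by (rule vec.span_scale)
    moreover have "(1 / \<delta>) *s (\<delta> *s axis l 1) = axis l 1"
      using assms by (simp add: vector_smult_assoc)
    ultimately show ?thesis
      by (simp only:)
  qed
  then have "vec.span cart_basis \<subseteq> vec.span ?T"
    by (intro vec.span_minimal vec.subspace_span) (auto simp: cart_basis_def)
  then show ?thesis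
    by (simp add: span_cart_basis top.extremum_uniqueI)
qed

lemma (in quadric_map) exists_linear_relation:
  assumes "p \<in> D" "herm p p = 1"
  shows "\<exists>e>0. \<exists>M c. (\<exists>k<M. c k \<noteq> 0) \<and> (\<forall>x\<in>ball p e. (\<Sum>k<M. c k * coord (F x) k) = 0)"
proof -
  obtain v where v: "herm v p = 0" "Re (herm v v) < 0"
    using exists_tangent_negative[OF assms(2)] by blast
  obtain \<eta> where \<eta>: "\<eta> > 0" "\<And>q w. q \<in> ball p \<eta> \<Longrightarrow> w \<in> ball v \<eta> \<Longrightarrow> good q w"
    using eventually_good[OF assms v] by blast
  obtain r where r: "r > 0" "ball p r \<subseteq> D"
    using open_D \<open>p \<in> D\<close> open_contains_ball by blast
  define e where "e = min \<eta> r"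
  have e: "e > 0" "ball p e \<subseteq> D" "ball p e \<subseteq> ball p \<eta>"
    using \<eta>(1) r by (auto simp: e_def)
  \<comment> \<open>The slab argument runs on the small ball, since base points of \<open>D\<close>
    far from \<open>p\<close> may fail to be good.\<close>
  interpret small: ell2_map "ball p e" F
    using hol e(2) by unfold_locales (auto simp: holomorphic_ell2_def)
  \<comment> \<open>The factor \<open>\<eta> / 2\<close> keeps the perturbed directions inside
    \<open>ball v \<eta>\<close>.\<close>
  define T where "T = insert v (range (\<lambda>l. v + complex_of_real (\<eta> / 2) *s axis l 1))"
  have "w \<in> ball v \<eta>" if "w \<in> T" for w
    using that \<eta>(1) by (auto simp: T_def dist_norm norm_vector_smult norm_axis_1)
  then have good: "good q w" if "q \<in> ball p e" "w \<in> T" for q w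
    using \<eta>(2) e(3) that by blast
  have "small.line_rank_less (b + 2) w" if "w \<in> T" for w
    unfolding small.line_rank_less_def
  proof (intro ballI allI impI)
    fix q t k assume "q \<in> ball p e" "\<forall>j<b + 2. q + t j *s w \<in> ball p e"
    then show "small.fminor (b + 2) k (\<lambda>j. q + t j *s w) = 0"
      using fminor_good_line[OF good] \<open>w \<in> T\<close> e(2) by blast
  qed
  moreover have "finite T" "vec.span T = UNIV"
    using \<eta>(1) by (simp_all add: T_def span_perturbed_axes)
  moreover have "ball p e \<noteq> {}"
    using e(1) by simp
  ultimately show ?thesis
    using small.linear_relation_of_rank_bound[of T "b + 2"] e(1) by blast
qed

section \<open>Identity theorem along a connected set\<close>

lemma (in ell2_map) comb_eq_0_of_ball:
  assumes "w \<in> D" "e > 0" "\<And>y. y \<in> ball w e \<Longrightarrow> y \<in> D \<Longrightarrow> comb M c y = 0" "x \<in> D"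
  shows "comb M c x = 0"
proof -
  have "comb M c (w + 1 *s (x - w)) = 0"
  proof (rule comb_affine_eq_0[where \<xi> = 0])
    show "open ({\<zeta>. w + \<zeta> *s (x - w) \<in> D} \<inter> {\<zeta>. w + \<zeta> *s (x - w) \<in> ball w e})"
      by (intro open_Int open_affine_preimage open_D open_ball)
  qed (use assms in auto)
  then show ?thesis by simp
qed

text \<open>Connectedness is given for \<open>U\<close> only, so the identity theorem is used on
  balls inside \<open>V\<close> and chained along \<open>U\<close>. The property passed on is
  vanishing on a whole ball, as the zeros in \<open>U\<close> alone do not propagate on
  lines.\<close>

lemma comb_eq_0_on_connected:
  assumes "open V" "holomorphic_ell2 F V" "connected U" "U \<subseteq> V" "p \<in> U" "e > 0"
    and "\<And>x. x \<in> ball p e \<Longrightarrow> ell2_map.comb F M c x = 0" "z \<in> U"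
  shows "ell2_map.comb F M c z = 0"
proof -
  let ?\<psi> = "ell2_map.comb F M c"
  have "\<exists>e>0. \<forall>w\<in>ball z e. ?\<psi> w = 0"
  proof (rule connected_induction_simple[OF \<open>connected U\<close> \<open>p \<in> U\<close> \<open>z \<in> U\<close>])
    show "\<exists>e>0. \<forall>w\<in>ball p e. ?\<psi> w = 0"
      using assms(6,7) by blast
    fix a assume "a \<in> U"
    then obtain r where r: "r > 0" "ball a r \<subseteq> V"
      using assms(1,4) open_contains_ball by blast
    interpret ell2_map "ball a r" F
      using assms(2) r(2) by unfold_locales (auto simp: holomorphic_ell2_def)
    have step: "\<exists>e>0. \<forall>w\<in>ball y e. ?\<psi> w = 0"
      if x: "x \<in> ball a r" "\<exists>e>0. \<forall>w\<in>ball x e. ?\<psi> w = 0" and y: "y \<in> ball a r" for x y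
    proof -
      obtain d where "d > 0" "\<forall>w\<in>ball x d. ?\<psi> w = 0"
        using x(2) by blast
      then have "\<forall>w\<in>ball a r. ?\<psi> w = 0"
        using comb_eq_0_of_ball[OF x(1)] by blast
      moreover obtain e where "e > 0" "ball y e \<subseteq> ball a r"
        using y open_ball open_contains_ball by blast
      ultimately show ?thesis by blast
    qed
    show "\<exists>T. openin (top_of_set U) T \<and> a \<in> T \<and> (\<forall>x\<in>T. \<forall>y\<in>T.
        (\<exists>e>0. \<forall>w\<in>ball x e. ?\<psi> w = 0) \<longrightarrow> (\<exists>e>0. \<forall>w\<in>ball y e. ?\<psi> w = 0))"
    proof (intro exI[of _ "U \<inter> ball a r"] conjI ballI impI)
      show "openin (top_of_set U) (U \<inter> ball a r)"
        by (intro openin_open_Int open_ball)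
    qed (use step \<open>a \<in> U\<close> r(1) in \<open>blast intro: centre_in_ball[THEN iffD2]\<close>)+
  qed
  then obtain d where "d > 0" "\<forall>w\<in>ball z d. ?\<psi> w = 0"
    by blast
  then show ?thesis by simp
qed

text \<open>The kernel of a nonzero continuous functional; the unit vector at \<open>k\<close> has
  the nonzero value \<open>c k\<close> and spans a complement.\<close>

lemma complex_hyperplane_kernel:
  assumes "k < M" "c k \<noteq> 0"
  shows "complex_hyperplane {x. (\<Sum>k<M. c k * coord x k) = 0}" (is "complex_hyperplane ?W")
proof -
  define L where "L x = (\<Sum>k<M. c k * coord x k)" for x
  have L_diff: "L (x - y) = L x - L y" and L_scale: "L (a *\<^sub>C x) = a * L x" and
    L_add: "L (x + y) = L x + L y" for x y a
    by (simp_all add: L_def sum_subtractf right_diff_distrib sum_distrib_left mult.left_commute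
        sum.distrib distrib_left)
  have W: "?W = {x. L x = 0}"
    by (simp add: L_def)
  have sub: "ell2.subspace ?W"
    unfolding W by (rule ell2.subspaceI) (simp_all add: L_scale L_add, simp add: L_def)
  have "continuous_on UNIV L"
    unfolding L_def
    by (intro continuous_intros bounded_linear.continuous_on[OF bounded_linear_coord])
  then have "closed ?W"
    unfolding W by (intro closed_Collect_eq continuous_on_const)
  have "summable (\<lambda>n. (cmod (if n = k then 1 else 0))\<^sup>2)"
    by (rule summable_finite[of "{k}"]) auto
  then obtain v where v: "coord v = (\<lambda>n. if n = k then 1 else 0)"
    by (metis Abs_ell2_inverse mem_Collect_eq)
  have "L v = (\<Sum>l\<in>{k}. c l * coord v l)"
    unfolding L_def by (rule sum.mono_neutral_right) (use assms(1) v in auto)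
  then have Lv: "L v \<noteq> 0"
    using assms(2) v by simp
  have "x \<in> ell2.span (insert v ?W)" for x
  proof -
    have "x - (L x / L v) *\<^sub>C v \<in> ?W"
      using Lv by (simp add: W L_diff L_scale)
    then show ?thesis
      unfolding ell2.span_insert by (blast intro: ell2.span_base)
  qed
  then have "ell2.span (insert v ?W) = UNIV" by blast
  moreover have "v \<notin> ?W"
    using Lv by (simp add: W)
  ultimately show ?thesis
    unfolding complex_hyperplane_def using sub \<open>closed ?W\<close>
    by (intro exI[of _ 0] exI[of _ ?W]) auto
qed

theorem corollary7p1:
  fixes U :: "(complex ^ ('a::finite + 'b::finite)) set"
    and f :: "complex ^ ('a + 'b) \<Rightarrow> ell2"
    and B :: enat
  assumes "CARD('a) \<ge> 2" and "CARD('b) \<ge> 1"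
    and "openin (top_of_set Q_fin) U" and "connected U" and "U \<noteq> {}"
    and "real_analytic_CR U (Q_inf B) f"
    and "\<not> (\<exists>H. complex_hyperplane H \<and> f ` U \<subseteq> H)"
  shows "B = \<infinity>"
proof (rule ccontr)
  assume "B \<noteq> \<infinity>"
  then obtain b where b: "B = enat b"
    by auto
  obtain V F where VF: "open V" "U \<subseteq> V" "holomorphic_ell2 F V" "\<And>z. z \<in> U \<Longrightarrow> F z = f z"
    and fQ: "f ` U \<subseteq> Q_inf B"
    using assms(6) unfolding real_analytic_CR_def by blast
  obtain O' where O': "open O'" "U = Q_fin \<inter> O'"
    using assms(3) by (auto simp: openin_open)
  obtain p where "p \<in> U"
    using assms(5) by blast
  then have "p \<in> V \<inter> O'" "herm p p = 1"
    using VF(2) O'(2) by (auto simp: Q_fin_iff)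
  \<comment> \<open>Inside \<open>O'\<close> every quadric point belongs to \<open>U\<close>, so
    \<open>F\<close> maps all quadric points of this ball into the target.\<close>
  then obtain r where r: "r > 0" "ball p r \<subseteq> V \<inter> O'"
    using VF(1) O'(1) open_contains_ball open_Int by metis
  interpret quadric_map "ball p r" F b
  proof unfold_locales
    show "holomorphic_ell2 F (ball p r)"
      using VF(3) r(2) by (auto simp: holomorphic_ell2_def)
    show "indef b (F z) (F z) = 1" if "z \<in> ball p r" "herm z z = 1" for z
    proof -
      have "z \<in> U"
        using that r(2) O'(2) by (auto simp: Q_fin_iff)
      then have "F z \<in> Q_inf (enat b)"
        using fQ VF(4) b by auto
      then show ?thesis
        by (simp add: Q_inf_enat_iff)
    qed
  qed (use assms(1) in auto)
  obtain e M c where e: "e > 0" and c: "\<exists>k<M. c k \<noteq> 0"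
    and rel: "\<And>x. x \<in> ball p e \<Longrightarrow> comb M c x = 0"
    using exists_linear_relation[OF centre_in_ball[THEN iffD2, OF r(1)] \<open>herm p p = 1\<close>]
    unfolding comb_def by blast
  \<comment> \<open>On \<open>U\<close> the maps \<open>F\<close> and \<open>f\<close> agree, so
    this relation puts the image of \<open>f\<close> in a hyperplane.\<close>
  have "comb M c z = 0" if "z \<in> U" for z
    by (rule comb_eq_0_on_connected[OF VF(1,3) assms(4) VF(2) \<open>p \<in> U\<close> e rel that])
  then have "f ` U \<subseteq> {x. (\<Sum>k<M. c k * coord x k) = 0}"
    using VF(4) by (auto simp: comb_def)
  then show False
    using assms(7) c complex_hyperplane_kernel by blast
qed

end
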